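(* Let $\Omega\subseteq\mathbb{R}^N$ be a bounded open set, and let $(p_n)$ be a sequence of measurable functions $p_n:\overline\Omega\to(1,+\infty)$ such that $p_n^-\to+\infty$ as $n\to\infty$ and there exists $\beta>1$ with $p_n^+\le\beta p_n^-$ for all $n$. Let $f:\Omega\times\mathbb{R}^d\times\mathbb{R}^{Nd}\to\mathbb{R}$ be a normal integrand such that (H1) for a.e. $x\in\Omega$ and every $u\in\mathbb{R}^d$, $f(x,u,\cdot)$ is level convex; and (H2) there exist $\alpha,\gamma>0$ with $f(x,u,\xi)\ge\alpha|\xi|^\gamma$ for a.e. $x\in\Omega$ and every $(u,\xi)\in\mathbb{R}^d\times\mathbb{R}^{Nd}$. Let $X\in\{L^\infty(\Omega,\mathbb{R}^d),C(\Omega,\mathbb{R}^d)\}$ be endowed with the norm $\|\cdot\|_\infty$. Define $\mathcal{F}_n,\mathcal{F}:X\to[0,+\infty]$ by $$\mathcal{F}_n(u):=\begin{cases}\displaystyle\int_\Omega\frac{1}{p_n(x)}f^{p_n(x)}(x,u(x),Du(x))\,dx&\text{if }u\in W^{1,p_n(\cdot)}(\Omega,\mathbb{R}^d),\\ +\infty&\text{otherwise,}\end{cases}$$ $$\mathcal{F}(u):=\begin{cases}0&\text{if }u\in W^{1,\infty}(\Omega,\mathbb{R}^d)\text{ and }\|f(\cdot,u(\cdot),Du(\cdot))\|_\infty\le1,\\ +\infty&\text{otherwise.}\end{cases}$$ Then: (i) for every $u\in X$ and every $(u_n)\subset X$ with $u_n\to u$ in $X$, $\mathcal{F}(u)\le\liminf_{n\to\infty}\mathcal{F}_n(u_n)$;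 (ii) for every $u\in X$ there exists $(u_n)\subset X$ with $u_n\to u$ in $X$ and $\limsup_{n\to\infty}\mathcal{F}_n(u_n)\le\mathcal{F}(u)$. In particular, $(\mathcal{F}_n)$ $\Gamma$-converges to $\mathcal{F}$ as $n\to\infty$ with respect to the strong $L^\infty$ convergence.
   Context: $p_n^-:=\operatorname{ess\,inf}_{\overline\Omega}p_n$, $p_n^+:=\operatorname{ess\,sup}_{\overline\Omega}p_n$. $W^{1,p(\cdot)}(\Omega,\mathbb{R}^d)$ is the set of $u:\Omega\to\mathbb{R}^d$ such that $|u|$ and $|\partial_i u|$ (weak derivatives) lie in $L^{p(\cdot)}(\Omega)=\{g\text{ measurable}:\int_\Omega|g|^{p(x)}dx<\infty\}$. A normal integrand is a $\mathcal{L}^N\otimes\mathcal{B}_d\otimes\mathcal{B}_{Nd}$-measurable function with $f(x,\cdot,\cdot)$ lower semicontinuous for a.e. $x$. $g$ is level convex if all sublevel sets $\{g\le t\}$ are convex. $\Gamma$-convergence in a metric space: for all $x$ and $x_n\to x$, $\varphi(x)\le\liminf\varphi_n(x_n)$, and for all $x$ there is $x_n\to x$ with $\varphi(x)=\lim\varphi_n(x_n)$. *)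

theory Defs
  imports "HOL-Analysis.Analysis" "HOL-Probability.Essential_Supremum"
begin

fun pderivs :: "'n list \<Rightarrow> (real^'n::finite \<Rightarrow> real) \<Rightarrow> real^'n \<Rightarrow> real" where
  "pderivs [] \<phi> = \<phi>"
| "pderivs (i # is) \<phi> = (\<lambda>x. frechet_derivative (pderivs is \<phi>) (at x) (axis i 1))"

definition smooth_fun :: "(real^'n::finite \<Rightarrow> real) \<Rightarrow> bool" where
  "smooth_fun \<phi> \<longleftrightarrow> (\<forall>is x. pderivs is \<phi> differentiable (at x))"

definition test_fun :: "(real^'n::finite) set \<Rightarrow> (real^'n \<Rightarrow> real) \<Rightarrow> bool" where
  "test_fun \<Omega> \<phi> \<longleftrightarrow> smooth_fun \<phi> \<and> (\<exists>K. compact K \<and> K \<subseteq> \<Omega> \<and> (\<forall>x. x \<notin> K \<longrightarrow> \<phi> x = 0))"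

definition weak_partial ::
  "(real^'n::finite) set \<Rightarrow> (real^'n \<Rightarrow> real^'d::finite) \<Rightarrow> 'n \<Rightarrow> (real^'n \<Rightarrow> real^'d) \<Rightarrow> bool" where
  "weak_partial \<Omega> u i v \<longleftrightarrow>
     (\<forall>\<phi>. test_fun \<Omega> \<phi> \<longrightarrow>
        integrable (lebesgue_on \<Omega>) (\<lambda>x. pderivs [i] \<phi> x *\<^sub>R u x) \<and>
        integrable (lebesgue_on \<Omega>) (\<lambda>x. \<phi> x *\<^sub>R v x) \<and>
        (\<integral>x. pderivs [i] \<phi> x *\<^sub>R u x \<partial>lebesgue_on \<Omega>) = - (\<integral>x. \<phi> x *\<^sub>R v x \<partial>lebesgue_on \<Omega>))"

(* Du is a weak Jacobian of u: (Du x)$k$i = \<partial>_i u_k (x); Du x \<in> R^{d\<times>N} = R^{Nd} *)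
definition weak_grad ::
  "(real^'n::finite) set \<Rightarrow> (real^'n \<Rightarrow> real^'d::finite) \<Rightarrow> (real^'n \<Rightarrow> real^'n^'d) \<Rightarrow> bool" where
  "weak_grad \<Omega> u Du \<longleftrightarrow> Du \<in> borel_measurable (lebesgue_on \<Omega>) \<and>
     (\<forall>i. weak_partial \<Omega> u i (\<lambda>x. column i (Du x)))"

definition var_Lp :: "(real^'n::finite) set \<Rightarrow> (real^'n \<Rightarrow> real) \<Rightarrow> (real^'n \<Rightarrow> real) \<Rightarrow> bool" where
  "var_Lp \<Omega> p g \<longleftrightarrow> g \<in> borel_measurable (lebesgue_on \<Omega>) \<and>
     (\<integral>\<^sup>+x. ennreal (\<bar>g x\<bar> powr p x) \<partial>lebesgue_on \<Omega>) < \<infinity>"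

definition var_W1p :: "(real^'n::finite) set \<Rightarrow> (real^'n \<Rightarrow> real) \<Rightarrow> (real^'n \<Rightarrow> real^'d::finite) \<Rightarrow> bool" where
  "var_W1p \<Omega> p u \<longleftrightarrow> u \<in> borel_measurable (lebesgue_on \<Omega>) \<and> var_Lp \<Omega> p (\<lambda>x. norm (u x)) \<and>
     (\<exists>Du. weak_grad \<Omega> u Du \<and> (\<forall>i. var_Lp \<Omega> p (\<lambda>x. norm (column i (Du x)))))"

definition Linf :: "(real^'n::finite) set \<Rightarrow> (real^'n \<Rightarrow> 'b::real_normed_vector) \<Rightarrow> bool" where
  "Linf \<Omega> g \<longleftrightarrow> g \<in> borel_measurable (lebesgue_on \<Omega>) \<and> (\<exists>C. AE x in lebesgue_on \<Omega>. norm (g x) \<le> C)"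

definition W1inf :: "(real^'n::finite) set \<Rightarrow> (real^'n \<Rightarrow> real^'d::finite) \<Rightarrow> bool" where
  "W1inf \<Omega> u \<longleftrightarrow> Linf \<Omega> u \<and> (\<exists>Du. weak_grad \<Omega> u Du \<and> Linf \<Omega> Du)"

definition Linf_space :: "(real^'n::finite) set \<Rightarrow> (real^'n \<Rightarrow> real^'d::finite) set" where
  "Linf_space \<Omega> = {u. Linf \<Omega> u}"

definition C_space :: "(real^'n::finite) set \<Rightarrow> (real^'n \<Rightarrow> real^'d::finite) set" where
  "C_space \<Omega> = {u. continuous_on \<Omega> u \<and> bounded (u ` \<Omega>)}"

definition Linf_conv :: "(real^'n::finite) set \<Rightarrow> (nat \<Rightarrow> real^'n \<Rightarrow> real^'d::finite) \<Rightarrow> (real^'n \<Rightarrow> real^'d) \<Rightarrow> bool" where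
  "Linf_conv \<Omega> us u \<longleftrightarrow>
     (\<forall>\<epsilon>>0. \<forall>\<^sub>F n in sequentially. AE x in lebesgue_on \<Omega>. norm (us n x - u x) \<le> \<epsilon>)"

definition p_minus :: "(real^'n::finite) set \<Rightarrow> (real^'n \<Rightarrow> real) \<Rightarrow> ereal" where
  "p_minus \<Omega> p = - esssup (lebesgue_on (closure \<Omega>)) (\<lambda>x. - ereal (p x))"

definition p_plus :: "(real^'n::finite) set \<Rightarrow> (real^'n \<Rightarrow> real) \<Rightarrow> ereal" where
  "p_plus \<Omega> p = esssup (lebesgue_on (closure \<Omega>)) (\<lambda>x. ereal (p x))"

definition lsc :: "('a::topological_space \<Rightarrow> real) \<Rightarrow> bool" where
  "lsc g \<longleftrightarrow> (\<forall>z c. c < g z \<longrightarrow> (\<forall>\<^sub>F w in nhds z. c < g w))"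

definition level_convex :: "('a::real_vector \<Rightarrow> real) \<Rightarrow> bool" where
  "level_convex g \<longleftrightarrow> (\<forall>t. convex {\<xi>. g \<xi> \<le> t})"

definition normal_integrand ::
  "(real^'n::finite) set \<Rightarrow> (real^'n \<Rightarrow> real^'d::finite \<Rightarrow> real^'n^'d \<Rightarrow> real) \<Rightarrow> bool" where
  "normal_integrand \<Omega> f \<longleftrightarrow>
     (\<lambda>(x, u, \<xi>). f x u \<xi>) \<in> borel_measurable (lebesgue_on \<Omega> \<Otimes>\<^sub>M (borel \<Otimes>\<^sub>M borel)) \<and>
     (AE x in lebesgue_on \<Omega>. lsc (\<lambda>(u, \<xi>). f x u \<xi>))"

definition F_n :: "(real^'n::finite) set \<Rightarrow> (real^'n \<Rightarrow> real^'d::finite \<Rightarrow> real^'n^'d \<Rightarrow> real)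
     \<Rightarrow> (real^'n \<Rightarrow> real) \<Rightarrow> (real^'n \<Rightarrow> real^'d) \<Rightarrow> ennreal" where
  "F_n \<Omega> f p u =
     (if var_W1p \<Omega> p u then
        (let Du = (SOME Du. weak_grad \<Omega> u Du) in
          \<integral>\<^sup>+x. ennreal (1 / p x * f x (u x) (Du x) powr p x) \<partial>lebesgue_on \<Omega>)
      else \<infinity>)"

definition F_lim :: "(real^'n::finite) set \<Rightarrow> (real^'n \<Rightarrow> real^'d::finite \<Rightarrow> real^'n^'d \<Rightarrow> real)
     \<Rightarrow> (real^'n \<Rightarrow> real^'d) \<Rightarrow> ennreal" where
  "F_lim \<Omega> f u =
     (if W1inf \<Omega> u \<and> (\<exists>Du. weak_grad \<Omega> u Du \<and>
            (AE x in lebesgue_on \<Omega>. \<bar>f x (u x) (Du x)\<bar> \<le> 1))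
      then 0 else \<infinity>)"

end

theory Submission
  imports Defs "HOL-Computational_Algebra.Polynomial"
begin

text \<open>
  Lower bound: along a subsequence of bounded energy and exponents growing to infinity, Markov's
  inequality and Borel-Cantelli give \<open>limsup f(x, u\<^sub>k(x), Du\<^sub>k(x)) \<le> 1\<close> for almost every \<open>x\<close>. Hence
  every limit point of \<open>Du\<^sub>k(x)\<close> lies in the closed convex set \<open>{\<xi>. f(x, u(x), \<xi>) \<le> 1}\<close>. The
  gradients are bounded in \<open>L\<^sup>2\<close>, so suitable convex combinations of their tails converge strongly
  and almost everywhere; the limit is the weak gradient of \<open>u\<close> and, by convexity, has its values in
  the same sets. This pointwise argument takes the place of Young measures.

  Upper bound: the constant sequence is a recovery sequence, because \<open>\<integral> 1/p\<^sub>n \<rightarrow> 0\<close>.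
\<close>

subsection \<open>Smooth test functions\<close>

text \<open>The obstacle is that \<open>f\<close> is only lower semicontinuous and level convex:
  \<open>F_n\<close> need not be convex in the gradient, so averaging gradients may destroy an
  energy bound. Averaging does respect convex sublevel sets at a single point, hence the energy
  bound is first turned into a statement at almost every x, and the averages are used only
  afterwards. They carry the same weights at all points, so the average of the gradients is a weak
  gradient of the average of the functions. The space L^2 is within reach because the exponents
  eventually exceed 4/\<gamma>, where coercivity bounds |Du|^2 by a constant plus a multiple of the
  energy density. In the upper bound the difficulty is the choice of gradient: \<open>F_n\<close>
  evaluates the one picked by \<open>SOME\<close>, while \<open>F_lim\<close> asserts that some
  gradient obeys the constraint. This calls for almost everywhere uniqueness of weak gradients,
  hence for a supply of explicit test functions. The ratio bound \<beta> makes each exponent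
  essentially bounded, which places W^{1,\<infinity>} inside every variable exponent space.\<close>

definition flat_exp :: "real poly \<Rightarrow> real \<Rightarrow> real" where
  "flat_exp q t = (if t \<le> 0 then 0 else poly q (1 / t) * exp (- (1 / t)))"

lemma poly_times_exp_minus_tendsto_0:
  "((\<lambda>s. poly q s * exp (- s)) \<longlongrightarrow> (0::real)) at_top"
proof -
  have "((\<lambda>s. \<Sum>i\<le>degree q. coeff q i * (s ^ i / exp s)) \<longlongrightarrow> (\<Sum>i\<le>degree q. coeff q i * 0)) at_top"
    by (intro tendsto_sum tendsto_mult tendsto_const tendsto_power_div_exp_0)
  then show ?thesis
    by (simp add: poly_altdef sum_distrib_right sum_divide_distrib exp_minus divide_inverse mult.assoc)
qed

text \<open>With s = 1/t, the derivative of q(s) exp(-s) in t is s^2 (q - q')(s) exp(-s), again a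
  member of the family, so one rule yields derivatives of every order. At t = 0 the right difference
  quotient is s q(s) exp(-s), which the exponential sends to 0.\<close>

lemma flat_exp_has_real_derivative:
  "(flat_exp q has_real_derivative flat_exp ([:0, 0, 1:] * (q - pderiv q)) t) (at t)"
proof -
  consider "t < 0" | "t > 0" | "t = 0" by linarith
  then show ?thesis
  proof cases
    case 1
    have "((\<lambda>_. 0) has_real_derivative 0) (at t)" by simp
    moreover have "\<forall>\<^sub>F s in nhds t. flat_exp q s = 0"
      using eventually_nhds_in_open[of "{..<0}" t] 1
      by (auto simp: flat_exp_def elim: eventually_mono)
    ultimately show ?thesis
      using 1 by (subst DERIV_cong_ev[OF refl _ refl, where g = "\<lambda>_. 0"]) (auto simp: flat_exp_def)
  next
    case 2
    have "((\<lambda>s. poly q (1 / s) * exp (- (1 / s))) has_real_derivative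
        flat_exp ([:0, 0, 1:] * (q - pderiv q)) t) (at t)"
      using 2 by (auto intro!: derivative_eq_intros DERIV_chain2[where f = "poly q", OF poly_DERIV]
          simp: flat_exp_def field_simps power2_eq_square)
    moreover have "\<forall>\<^sub>F s in nhds t. flat_exp q s = poly q (1 / s) * exp (- (1 / s))"
      using eventually_nhds_in_open[of "{0<..}" t] 2
      by (auto simp: flat_exp_def elim: eventually_mono)
    ultimately show ?thesis
      by (subst DERIV_cong_ev[OF refl _ refl]) auto
  next
    case 3
    have "((\<lambda>h. flat_exp q h / h) \<longlongrightarrow> 0) (at_left 0)"
    proof (rule tendsto_eventually)
      show "\<forall>\<^sub>F h in at_left 0. flat_exp q h / h = 0"
        by (auto simp: flat_exp_def eventually_at_filter)
    qed
    moreover have "((\<lambda>h. flat_exp q h / h) \<longlongrightarrow> 0) (at_right 0)"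
    proof (rule Lim_transform_eventually)
      show "((\<lambda>h. poly ([:0, 1:] * q) (inverse h) * exp (- inverse h)) \<longlongrightarrow> 0) (at_right (0::real))"
        by (rule filterlim_compose[OF poly_times_exp_minus_tendsto_0 filterlim_inverse_at_top_right])
      show "\<forall>\<^sub>F h in at_right 0. poly ([:0, 1:] * q) (inverse h) * exp (- inverse h) = flat_exp q h / h"
        by (auto simp: flat_exp_def eventually_at_filter field_simps)
    qed
    ultimately have "((\<lambda>h. flat_exp q h / h) \<longlongrightarrow> 0) (at 0)"
      by (simp add: filterlim_at_split)
    then show ?thesis
      using 3 by (simp add: DERIV_def flat_exp_def)
  qed
qed

text \<open>The rules are chosen so that partial derivatives stay in the class; membership then
  gives \<open>smooth_fun\<close> by induction on the list of directions. The rule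
  \<open>exp\<close> serves the cutoffs 1 - exp(-k b), with b a bump, that approximate indicators of
  boxes.\<close>

inductive smooth_elem :: "(real^'n::finite \<Rightarrow> real) \<Rightarrow> bool" where
  const: "smooth_elem (\<lambda>x. c)"
| flat: "smooth_elem (\<lambda>x. flat_exp q (s * x $ i + a))"
| add: "smooth_elem f \<Longrightarrow> smooth_elem g \<Longrightarrow> smooth_elem (\<lambda>x. f x + g x)"
| mult: "smooth_elem f \<Longrightarrow> smooth_elem g \<Longrightarrow> smooth_elem (\<lambda>x. f x * g x)"
| exp: "smooth_elem f \<Longrightarrow> smooth_elem (\<lambda>x. exp (f x))"

lemma smooth_elem_prod:
  "finite A \<Longrightarrow> (\<And>i. i \<in> A \<Longrightarrow> smooth_elem (f i)) \<Longrightarrow> smooth_elem (\<lambda>x. \<Prod>i\<in>A. f i x)"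
proof (induction A rule: finite_induct)
  case empty
  then show ?case using smooth_elem.const[of 1] by simp
next
  case (insert i A)
  then show ?case using smooth_elem.mult[of "f i"] by simp
qed

lemma smooth_elem_has_derivative:
  fixes f :: "real^'n::finite \<Rightarrow> real"
  assumes "smooth_elem f"
  shows "\<exists>D. (\<forall>x. (f has_derivative D x) (at x)) \<and> (\<forall>i. smooth_elem (\<lambda>x. D x (axis i 1)))"
  using assms
proof induction
  case (const c)
  show ?case
    by (rule exI[of _ "\<lambda>x h. 0"]) (auto intro: smooth_elem.const)
next
  case (flat q s i a)
  let ?q = "[:0, 0, 1:] * (q - pderiv q)"
  have "((\<lambda>x. flat_exp q (s * x $ i + a)) has_derivative
      (\<lambda>h. flat_exp ?q (s * x $ i + a) * (s * h $ i))) (at x)" for x :: "real^'n"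
  proof -
    have "((\<lambda>x. s * x $ i + a) has_derivative (\<lambda>h. s * h $ i)) (at x)"
      by (auto intro!: derivative_eq_intros bounded_linear_imp_has_derivative
          bounded_linear_vec_nth)
    from has_derivative_compose[OF this
        flat_exp_has_real_derivative[unfolded has_field_derivative_def]]
    show ?thesis .
  qed
  moreover have "smooth_elem (\<lambda>x. flat_exp ?q (s * x $ i + a) * (s * axis j 1 $ i))" for j
    by (intro smooth_elem.intros)
  ultimately show ?case
    by (intro exI[of _ "\<lambda>x h. flat_exp ?q (s * x $ i + a) * (s * h $ i)"]) auto
next
  case (add f g)
  then obtain D E where "\<forall>x. (f has_derivative D x) (at x)" "\<forall>i. smooth_elem (\<lambda>x. D x (axis i 1))"
    "\<forall>x. (g has_derivative E x) (at x)" "\<forall>i. smooth_elem (\<lambda>x. E x (axis i 1))"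
    by auto
  then show ?case
    by (intro exI[of _ "\<lambda>x h. D x h + E x h"])
      (auto intro!: has_derivative_add smooth_elem.intros)
next
  case (mult f g)
  then obtain D E where "\<forall>x. (f has_derivative D x) (at x)" "\<forall>i. smooth_elem (\<lambda>x. D x (axis i 1))"
    "\<forall>x. (g has_derivative E x) (at x)" "\<forall>i. smooth_elem (\<lambda>x. E x (axis i 1))"
    by auto
  with mult.hyps show ?case
    by (intro exI[of _ "\<lambda>x h. f x * E x h + D x h * g x"])
      (auto intro!: has_derivative_mult smooth_elem.intros)
next
  case (exp f)
  then obtain D where "\<forall>x. (f has_derivative D x) (at x)" "\<forall>i. smooth_elem (\<lambda>x. D x (axis i 1))"
    by auto
  with exp.hyps show ?case
    by (intro exI[of _ "\<lambda>x h. exp (f x) * D x h"])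
      (auto intro!: derivative_eq_intros smooth_elem.intros)
qed

lemma smooth_elem_imp_smooth_fun:
  fixes f :: "real^'n::finite \<Rightarrow> real"
  assumes "smooth_elem f"
  shows "smooth_fun f"
proof -
  have partial: "g differentiable (at x) \<and>
      smooth_elem (\<lambda>x. frechet_derivative g (at x) (axis i 1))" if "smooth_elem g" for g :: "real^'n \<Rightarrow> real" and i x
  proof -
    obtain D where D: "\<And>x. (g has_derivative D x) (at x)" "\<And>i. smooth_elem (\<lambda>x. D x (axis i 1))"
      using smooth_elem_has_derivative[OF \<open>smooth_elem g\<close>] by blast
    have "frechet_derivative g (at x) = D x" for x
      using frechet_derivative_at[OF D(1)] by simp
    with D show ?thesis by (auto simp: differentiable_def)
  qed
  have "smooth_elem (pderivs is f)" for "is"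
    by (induction "is") (use assms partial in auto)
  with partial show ?thesis by (auto simp: smooth_fun_def)
qed

section \<open>Bump functions on boxes\<close>

text \<open>With \<open>q = 1\<close> a factor is exp(-1/t) for t > 0 and 0 otherwise, so the
  product is positive exactly on the open box. The coefficients \<open>1\<close> and
  \<open>- 1\<close> bring the arguments into the form of the rule \<open>flat\<close>.\<close>

definition box_bump :: "real^'n::finite \<Rightarrow> real^'n \<Rightarrow> real^'n \<Rightarrow> real" where
  "box_bump a b x = (\<Prod>i\<in>UNIV. flat_exp 1 (1 * x $ i + (- a $ i)) * flat_exp 1 ((- 1) * x $ i + b $ i))"

lemma smooth_elem_box_bump: "smooth_elem (box_bump a b)"
  unfolding box_bump_def[abs_def] by (intro smooth_elem_prod smooth_elem.mult smooth_elem.flat) auto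

lemma box_bump_pos: "x \<in> box a b \<Longrightarrow> box_bump a b x > 0"
  unfolding box_bump_def by (intro prod_pos) (auto simp: flat_exp_def mem_box_cart not_less[symmetric])

lemma box_bump_eq_0: "x \<notin> box a b \<Longrightarrow> box_bump a b x = 0"
  unfolding box_bump_def by (force simp: flat_exp_def mem_box_cart not_less)

lemma box_bump_nonneg: "box_bump a b x \<ge> 0"
  using box_bump_pos[of x a b] box_bump_eq_0[of x a b] by (cases "x \<in> box a b") auto

text \<open>The bump provides the compact support, which leaves \<open>f\<close> free to range over
  the whole class; a fixed bump times varying \<open>f\<close> is how box indicators are reached
  later.\<close>

lemma test_fun_box_bump_mult:
  assumes "cbox a b \<subseteq> \<Omega>" and "smooth_elem f"
  shows "test_fun \<Omega> (\<lambda>x. box_bump a b x * f x)"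
  unfolding test_fun_def
proof (intro conjI exI[of _ "cbox a b"] allI impI)
  show "smooth_fun (\<lambda>x. box_bump a b x * f x)"
    by (intro smooth_elem_imp_smooth_fun smooth_elem.mult smooth_elem_box_bump assms)
  show "box_bump a b x * f x = 0" if "x \<notin> cbox a b" for x
    using that box_subset_cbox[of a b] box_bump_eq_0[of x a b] by auto
qed (use assms in auto)

subsection \<open>Uniqueness of weak gradients\<close>

text \<open>The positive and negative parts of \<open>w\<close> are densities of two measures that
  agree on boxes. Boxes form an intersection-stable generator of the Borel sets, so the measures and
  then the densities coincide, and w^+ = w^- forces w = 0.\<close>

lemma AE_eq_0_if_box_integrals_eq_0:
  fixes w :: "'a::euclidean_space \<Rightarrow> real"
  assumes w: "integrable lborel w"
    and zero: "\<And>a b. (\<integral>x. indicator (box a b) x * w x \<partial>lborel) = 0"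
  shows "AE x in lborel. w x = 0"
proof -
  have [measurable]: "w \<in> borel_measurable borel"
    using borel_measurable_integrable[OF w] by simp
  \<comment> \<open>\<open>ennreal\<close> truncates negative reals to 0, so the two densities are
    w^+ and w^-.\<close>
  let ?M = "density lborel (\<lambda>x. ennreal (w x))" and ?N = "density lborel (\<lambda>x. ennreal (- w x))"
  have fin: "(\<integral>\<^sup>+x. ennreal (w x) * indicator (box a b) x \<partial>lborel) < \<infinity>"
    "(\<integral>\<^sup>+x. ennreal (- w x) * indicator (box a b) x \<partial>lborel) < \<infinity>"
    "(\<integral>\<^sup>+x. ennreal (w x) * indicator (box a b) x \<partial>lborel)
      = (\<integral>\<^sup>+x. ennreal (- w x) * indicator (box a b) x \<partial>lborel)" for a b
  proof -
    let ?v = "\<lambda>x. indicator (box a b) x * w x"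
    have v: "integrable lborel ?v"
      using integrable_mult_indicator[of "box a b" lborel w] w by simp
    have eq: "ennreal (w x) * indicator (box a b) x = ennreal (?v x)"
      "ennreal (- w x) * indicator (box a b) x = ennreal (- ?v x)" for x
      by (auto simp: indicator_def)
    have f: "(\<integral>\<^sup>+x. ennreal (?v x) \<partial>lborel) < \<infinity>" "(\<integral>\<^sup>+x. ennreal (- ?v x) \<partial>lborel) < \<infinity>"
      using v by (auto simp: real_integrable_def top.not_eq_extremum)
    have "enn2real (\<integral>\<^sup>+x. ennreal (?v x) \<partial>lborel) = enn2real (\<integral>\<^sup>+x. ennreal (- ?v x) \<partial>lborel)"
      using zero[of a b] real_lebesgue_integral_def[OF v] by simp
    then have "(\<integral>\<^sup>+x. ennreal (?v x) \<partial>lborel) = (\<integral>\<^sup>+x. ennreal (- ?v x) \<partial>lborel)"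
      using f by (metis ennreal_enn2real infinity_ennreal_def)
    with f eq
    show "(\<integral>\<^sup>+x. ennreal (w x) * indicator (box a b) x \<partial>lborel) < \<infinity>"
      "(\<integral>\<^sup>+x. ennreal (- w x) * indicator (box a b) x \<partial>lborel) < \<infinity>"
      "(\<integral>\<^sup>+x. ennreal (w x) * indicator (box a b) x \<partial>lborel)
        = (\<integral>\<^sup>+x. ennreal (- w x) * indicator (box a b) x \<partial>lborel)"
      by simp_all
  qed
  let ?E = "range (\<lambda>(a, b). box a b :: 'a set)"
  have "?M = ?N"
  proof (rule measure_eqI_generator_eq)
    show "Int_stable ?E"
      by (auto simp: Int_stable_def box_Int_box)
    show "?E \<subseteq> Pow UNIV" "sets ?M = sigma_sets UNIV ?E" "sets ?N = sigma_sets UNIV ?E"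
      by (simp_all add: borel_eq_box)
    let ?A = "\<lambda>n::nat. box (- (real n *\<^sub>R One)) (real n *\<^sub>R One) :: 'a set"
    show "range ?A \<subseteq> ?E" "(\<Union>i. ?A i) = UNIV"
      unfolding UN_box_eq_UNIV by auto
    show "emeasure ?M (?A i) \<noteq> \<infinity>" for i
      using fin(1)[THEN less_imp_neq] by (simp add: emeasure_density)
    show "emeasure ?M X = emeasure ?N X" if "X \<in> ?E" for X
      using that fin(3) by (auto simp: emeasure_density)
  qed
  then have "AE x in lborel. ennreal (w x) = ennreal (- w x)"
    by (intro sigma_finite_measure.density_unique[OF sigma_finite_lborel]) auto
  then show ?thesis
  proof eventually_elim
    case (elim x)
    then show ?case
      by (cases "w x \<ge> 0") (auto simp: ennreal_neg ennreal_eq_0_iff dest: sym)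
  qed
qed

text \<open>Boxes generate only the Borel sets, so a Lebesgue measurable \<open>w\<close> is first
  exchanged for a Borel function equal to it almost everywhere.\<close>

lemma AE_lebesgue_eq_0_if_box_integrals_eq_0:
  fixes w :: "'a::euclidean_space \<Rightarrow> real"
  assumes w: "integrable lebesgue w"
    and zero: "\<And>a b. (\<integral>x. indicator (box a b) x * w x \<partial>lebesgue) = 0"
  shows "AE x in lebesgue. w x = 0"
proof -
  obtain w' where w'[measurable]: "w' \<in> borel_measurable lborel" and eq: "AE x in lborel. w x = w' x"
    using completion_ex_borel_measurable_real[of w lborel] w by auto
  have eq': "AE x in lebesgue. w x = w' x"
    using eq by (rule AE_completion)
  have [measurable]: "w \<in> borel_measurable lebesgue" "w' \<in> borel_measurable lebesgue"
    using w by (auto intro: measurable_completion)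
  have "AE x in lborel. w' x = 0"
  proof (rule AE_eq_0_if_box_integrals_eq_0)
    have "integrable lebesgue w'"
      using integrable_cong_AE[OF _ _ eq'] w by simp
    then show "integrable lborel w'"
      by (simp add: integrable_completion)
    fix a b
    have "(\<integral>x. indicator (box a b) x * w' x \<partial>lborel) = (\<integral>x. indicator (box a b) x * w' x \<partial>lebesgue)"
      by (rule integral_completion[symmetric]) simp
    also have "\<dots> = (\<integral>x. indicator (box a b) x * w x \<partial>lebesgue)"
      by (rule integral_cong_AE) (use eq' in \<open>auto intro!: borel_measurable_times borel_measurable_indicator\<close>)
    finally show "(\<integral>x. indicator (box a b) x * w' x \<partial>lborel) = 0"
      by (simp add: zero)
  qed
  then have "AE x in lebesgue. w' x = 0"
    by (rule AE_completion)
  with eq' show ?thesis by eventually_elim simp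
qed

text \<open>The fundamental lemma of the calculus of variations. On a closed box inside \<Omega>,
  \<open>w\<close> times a fixed bump is tested against smooth functions tending boundedly to the
  indicator of an arbitrary box; dominated convergence makes all its box integrals vanish. Countably
  many boxes cover \<Omega>.\<close>

lemma AE_eq_0_if_test_integrals_eq_0:
  fixes w :: "real^'n::finite \<Rightarrow> real"
  assumes "open \<Omega>"
    and int: "\<And>\<phi>. test_fun \<Omega> \<phi> \<Longrightarrow> integrable (lebesgue_on \<Omega>) (\<lambda>x. \<phi> x * w x)"
    and zero: "\<And>\<phi>. test_fun \<Omega> \<phi> \<Longrightarrow> (\<integral>x. \<phi> x * w x \<partial>lebesgue_on \<Omega>) = 0"
  shows "AE x in lebesgue_on \<Omega>. w x = 0"
proof -
  have \<Omega>: "\<Omega> \<in> sets lebesgue"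
    using \<open>open \<Omega>\<close> by simp
  have box: "AE x in lebesgue. x \<in> box a b \<longrightarrow> w x = 0" if ab: "cbox a b \<subseteq> \<Omega>" for a b
  proof -
    define v where "v x = box_bump a b x * w x" for x
    \<comment> \<open>The bump vanishes outside \<Omega>, so integrals over \<Omega> become
      integrals over the whole space.\<close>
    have ind: "indicat_real \<Omega> x * (box_bump a b x * f x * w x) = f x * v x" for f :: "real^'n \<Rightarrow> real" and x
      using ab box_bump_eq_0[of x a b] box_subset_cbox[of a b]
      by (cases "x \<in> \<Omega>") (auto simp: v_def)
    have smooth: "integrable lebesgue (\<lambda>x. f x * v x)" "(\<integral>x. f x * v x \<partial>lebesgue) = 0"
      if "smooth_elem f" for f
      using int[OF test_fun_box_bump_mult[OF ab that]] zero[OF test_fun_box_bump_mult[OF ab that]] \<Omega>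
      by (simp_all add: integrable_restrict_space integral_restrict_space ind)
    have v: "integrable lebesgue v"
      using smooth(1)[OF smooth_elem.const[of 1]] by simp
    have "AE x in lebesgue. v x = 0"
    proof (rule AE_lebesgue_eq_0_if_box_integrals_eq_0[OF v])
      fix c d :: "real^'n"
      \<comment> \<open>Values in [0,1], equal to 0 off the box and increasing to 1 inside it as k
        grows. The sum and products are spelled out to match the rules of
        \<open>smooth_elem\<close>.\<close>
      define g where "g k x = 1 + (- 1) * exp ((- real k) * box_bump c d x)" for k x
      have g: "smooth_elem (g k)" for k
        unfolding g_def[abs_def] by (intro smooth_elem.intros smooth_elem_box_bump)
      have "(\<lambda>k. \<integral>x. g k x * v x \<partial>lebesgue) \<longlonglongrightarrow> (\<integral>x. indicator (box c d) x * v x \<partial>lebesgue)"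
      proof (rule integral_dominated_convergence[where w = "\<lambda>x. \<bar>v x\<bar>"])
        show "(\<lambda>x. indicator (box c d) x * v x) \<in> borel_measurable lebesgue"
          using v by (auto intro!: borel_measurable_times borel_measurable_indicator)
        show "(\<lambda>x. g k x * v x) \<in> borel_measurable lebesgue" for k
          using smooth(1)[OF g] by auto
        show "AE x in lebesgue. norm (g k x * v x) \<le> \<bar>v x\<bar>" for k
        proof (rule AE_I2)
          fix x
          have "\<bar>g k x\<bar> \<le> 1"
            using box_bump_nonneg[of c d x] by (auto simp: g_def abs_le_iff)
          then show "norm (g k x * v x) \<le> \<bar>v x\<bar>"
            by (simp add: abs_mult mult_left_le_one_le)
        qed
        show "AE x in lebesgue. (\<lambda>k. g k x * v x) \<longlonglongrightarrow> indicator (box c d) x * v x"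
        proof (rule AE_I2)
          fix x
          have "(\<lambda>k. g k x) \<longlonglongrightarrow> indicator (box c d) x"
          proof (cases "x \<in> box c d")
            case True
            have "filterlim (\<lambda>k. real k * box_bump c d x) at_top sequentially"
              using filterlim_tendsto_pos_mult_at_top[OF tendsto_const box_bump_pos[OF True] filterlim_real_sequentially]
              by (simp add: mult.commute)
            then have "(\<lambda>k. exp (- (real k * box_bump c d x))) \<longlonglongrightarrow> 0"
              by (intro filterlim_compose[OF exp_at_bot])
                (simp add: filterlim_uminus_at_bot)
            then have "(\<lambda>k. 1 - exp (- (real k * box_bump c d x))) \<longlonglongrightarrow> 1 - 0"
              by (intro tendsto_intros)
            then show ?thesis using True by (simp add: g_def)
          next
            case False
            then show ?thesis by (simp add: g_def box_bump_eq_0)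
          qed
          then show "(\<lambda>k. g k x * v x) \<longlonglongrightarrow> indicator (box c d) x * v x"
            by (intro tendsto_mult tendsto_const)
        qed
      qed (use v in auto)
      then show "(\<integral>x. indicator (box c d) x * v x \<partial>lebesgue) = 0"
        using smooth(2)[OF g] by (simp add: LIMSEQ_const_iff)
    qed
    then show ?thesis
    proof eventually_elim
      case (elim x)
      then show ?case using box_bump_pos[of x a b] by (auto simp: v_def)
    qed
  qed
  obtain \<D> where \<D>: "countable \<D>" "\<D> \<subseteq> Pow \<Omega>" "\<And>X. X \<in> \<D> \<Longrightarrow> \<exists>a b. X = cbox a b" "\<Union>\<D> = \<Omega>"
    using open_countable_Union_open_cbox[OF \<open>open \<Omega>\<close>] by metis
  have "AE x in lebesgue. \<forall>X\<in>\<D>. x \<in> X \<longrightarrow> w x = 0"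
  proof (subst AE_ball_countable[OF \<D>(1)], rule ballI)
    fix X assume X: "X \<in> \<D>"
    then obtain a b where ab: "X = cbox a b" using \<D>(3) by blast
    with X \<D>(2) have sub: "cbox a b \<subseteq> \<Omega>" by auto
    \<comment> \<open>The cover consists of closed boxes, while the bump is positive on open ones;
      the difference is a null set.\<close>
    have "AE x in lebesgue. x \<notin> cbox a b - box a b"
      using negligible_frontier_interval[of a b] by (intro AE_not_in) (simp add: negligible_iff_null_sets)
    then show "AE x in lebesgue. x \<in> X \<longrightarrow> w x = 0"
      unfolding ab using box[OF sub] by eventually_elim auto
  qed
  then have "AE x in lebesgue. x \<in> \<Omega> \<longrightarrow> w x = 0"
    by eventually_elim (use \<D>(4) in blast)
  then show ?thesis
    using \<Omega> by (simp add: AE_restrict_space_iff)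
qed

text \<open>This lets the gradient selected by \<open>SOME\<close> in \<open>F_n\<close> inherit the
  bound that \<open>F_lim\<close> provides for a possibly different representative.\<close>

lemma weak_grad_unique:
  fixes u :: "real^'n::finite \<Rightarrow> real^'d::finite"
  assumes "open \<Omega>" "weak_grad \<Omega> u D" "weak_grad \<Omega> u E"
  shows "AE x in lebesgue_on \<Omega>. D x = E x"
proof -
  have "AE x in lebesgue_on \<Omega>. D x $ k $ i - E x $ k $ i = 0" for k i
  proof (rule AE_eq_0_if_test_integrals_eq_0[OF \<open>open \<Omega>\<close>])
    fix \<phi> assume \<phi>: "test_fun \<Omega> \<phi>"
    have comp: "integrable (lebesgue_on \<Omega>) (\<lambda>x. \<phi> x * D x $ k $ i) \<and>
        (\<integral>x. \<phi> x * D x $ k $ i \<partial>lebesgue_on \<Omega>)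
          = - (\<integral>x. pderivs [i] \<phi> x *\<^sub>R u x \<partial>lebesgue_on \<Omega>) $ k"
      if "weak_grad \<Omega> u D" for D
    proof -
      have *: "integrable (lebesgue_on \<Omega>) (\<lambda>x. \<phi> x *\<^sub>R column i (D x))"
        "(\<integral>x. pderivs [i] \<phi> x *\<^sub>R u x \<partial>lebesgue_on \<Omega>)
          = - (\<integral>x. \<phi> x *\<^sub>R column i (D x) \<partial>lebesgue_on \<Omega>)"
        using that \<phi> by (auto simp: weak_grad_def weak_partial_def)
      show ?thesis
        using integrable_bounded_linear[OF bounded_linear_vec_nth *(1), of k]
          integral_bounded_linear[OF bounded_linear_vec_nth *(1), of k]
        by (simp add: *(2) column_def del: pderivs.simps)
    qed
    from comp[OF assms(2)] comp[OF assms(3)]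
    show "integrable (lebesgue_on \<Omega>) (\<lambda>x. \<phi> x * (D x $ k $ i - E x $ k $ i))"
      "(\<integral>x. \<phi> x * (D x $ k $ i - E x $ k $ i) \<partial>lebesgue_on \<Omega>) = 0"
      by (auto simp: right_diff_distrib)
  qed
  then have "AE x in lebesgue_on \<Omega>. \<forall>k i. D x $ k $ i - E x $ k $ i = 0"
    by (simp add: AE_all_countable)
  then show ?thesis
    by eventually_elim (simp add: vec_eq_iff)
qed

subsection \<open>Strong convergence of convex combinations in \<open>L\<^sup>2\<close>\<close>

text \<open>Closure under midpoints is all that the parallelogram law below needs from convex hulls; the
  values are pairs, so that averaging a function and its gradient keeps them matched.\<close>

inductive_set mid_hull :: "(nat \<Rightarrow> 'a \<Rightarrow> 'b::real_vector) \<Rightarrow> nat \<Rightarrow> ('a \<Rightarrow> 'b) set"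
  for h :: "nat \<Rightarrow> 'a \<Rightarrow> 'b" and n :: nat where
  base: "n \<le> k \<Longrightarrow> h k \<in> mid_hull h n"
| mid: "g \<in> mid_hull h n \<Longrightarrow> g' \<in> mid_hull h n \<Longrightarrow> (\<lambda>x. (1 / 2) *\<^sub>R (g x + g' x)) \<in> mid_hull h n"

lemma mid_hull_antimono: "m \<le> n \<Longrightarrow> mid_hull h n \<subseteq> mid_hull h m"
proof
  fix g assume "m \<le> n" "g \<in> mid_hull h n"
  from this(2,1) show "g \<in> mid_hull h m"
    by induction (auto intro: mid_hull.intros)
qed

text \<open>The weights of an average do not depend on the point, so \<open>x\<close> is fixed first
  and \<open>K\<close> may vary with it.\<close>

lemma mid_hull_in_convex:
  assumes "g \<in> mid_hull h n" "convex K" "\<And>k. n \<le> k \<Longrightarrow> h k x \<in> K"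
  shows "g x \<in> K"
  using assms(1)
proof induction
  case (mid g g')
  then show ?case
    using convexD[OF assms(2), of "g x" "g' x" "1/2" "1/2"] by (simp add: scaleR_add_right)
qed (use assms in auto)

lemma norm_mid_power2:
  fixes a b :: "'a::real_inner"
  shows "(norm ((1 / 2) *\<^sub>R (a + b)))\<^sup>2 = (norm a)\<^sup>2 / 2 + (norm b)\<^sup>2 / 2 - (norm (a - b))\<^sup>2 / 4"
  by (simp add: power2_norm_eq_inner algebra_simps inner_commute field_simps)

lemma norm_mid_power2_le:
  fixes a b :: "'a::real_inner"
  shows "(norm ((1 / 2) *\<^sub>R (a + b)))\<^sup>2 \<le> (norm a)\<^sup>2 / 2 + (norm b)\<^sup>2 / 2"
  unfolding norm_mid_power2 by simp

lemma mid_hull_square_integrable: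
  fixes h :: "nat \<Rightarrow> 'a \<Rightarrow> 'e::real_vector \<times> 'b::euclidean_space"
  assumes h: "\<And>k. (\<lambda>x. snd (h k x)) \<in> borel_measurable M"
    "\<And>k. integrable M (\<lambda>x. (norm (snd (h k x)))\<^sup>2)"
    and g: "g \<in> mid_hull h n"
  shows "(\<lambda>x. snd (g x)) \<in> borel_measurable M" "integrable M (\<lambda>x. (norm (snd (g x)))\<^sup>2)"
proof -
  have "(\<lambda>x. snd (g x)) \<in> borel_measurable M \<and> integrable M (\<lambda>x. (norm (snd (g x)))\<^sup>2)"
    using g
  proof induction
    case (base k)
    then show ?case using h by auto
  next
    case (mid g g')
    then have [measurable]: "(\<lambda>x. snd (g x)) \<in> borel_measurable M" "(\<lambda>x. snd (g' x)) \<in> borel_measurable M"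
      by auto
    have "integrable M (\<lambda>x. (norm (snd (g x)))\<^sup>2 / 2 + (norm (snd (g' x)))\<^sup>2 / 2)"
      using mid by auto
    then have "integrable M (\<lambda>x. (norm ((1 / 2) *\<^sub>R (snd (g x) + snd (g' x))))\<^sup>2)"
    proof (rule Bochner_Integration.integrable_bound)
      show "AE x in M. norm ((norm ((1 / 2) *\<^sub>R (snd (g x) + snd (g' x))))\<^sup>2)
          \<le> norm ((norm (snd (g x)))\<^sup>2 / 2 + (norm (snd (g' x)))\<^sup>2 / 2)"
        using norm_mid_power2_le by (intro AE_I2) (simp only: real_norm_def abs_of_nonneg zero_le_power2 add_nonneg_nonneg divide_nonneg_pos zero_less_numeral)
    qed measurable
    with mid show ?case by auto
  qed
  then show "(\<lambda>x. snd (g x)) \<in> borel_measurable M" "integrable M (\<lambda>x. (norm (snd (g x)))\<^sup>2)"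
    by auto
qed

text \<open>Near-minimisers of the \<open>L\<^sup>2\<close> norm over the hulls of the tails form a Cauchy
  sequence by the parallelogram law; this replaces weak compactness and Mazur's lemma.\<close>

lemma mid_hull_Cauchy:
  fixes h :: "nat \<Rightarrow> 'a \<Rightarrow> 'e::real_vector \<times> 'b::euclidean_space"
  assumes h: "\<And>k. (\<lambda>x. snd (h k x)) \<in> borel_measurable M"
    "\<And>k. integrable M (\<lambda>x. (norm (snd (h k x)))\<^sup>2)"
    and B: "\<And>k. (\<integral>x. (norm (snd (h k x)))\<^sup>2 \<partial>M) \<le> B"
  obtains g where "\<And>n. g n \<in> mid_hull h n"
    "\<And>e. e > 0 \<Longrightarrow> \<exists>N. \<forall>m\<ge>N. \<forall>n\<ge>N. (\<integral>x. (norm (snd (g n x) - snd (g m x)))\<^sup>2 \<partial>M) \<le> e"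
proof -
  define J where "J g = (\<integral>x. (norm (snd (g x)))\<^sup>2 \<partial>M)" for g :: "'a \<Rightarrow> 'e \<times> 'b"
  define I where "I n = (INF g\<in>mid_hull h n. J g)" for n
  note sq = mid_hull_square_integrable[OF h]
  have J0: "0 \<le> J g" for g by (simp add: J_def)
  have bdd: "bdd_below (J ` A)" for A by (rule bdd_belowI[of _ 0]) (auto simp: J0)
  have ne: "h n \<in> mid_hull h n" for n by (simp add: mid_hull.base)
  have I_le: "I n \<le> J g" if "g \<in> mid_hull h n" for g n
    unfolding I_def using that bdd by (intro cINF_lower)
  have I_mono: "I m \<le> I n" if "m \<le> n" for m n
    unfolding I_def using ne[of n] by (intro cINF_superset_mono bdd mid_hull_antimono that) auto
  have "I n \<le> B" for n
    using I_le[OF ne[of n]] B[of n] by (simp add: J_def)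
  then have "bdd_above (range I)" by (intro bdd_aboveI[of _ B]) auto
  \<comment> \<open>The hulls shrink as n grows, so \<open>I\<close> increases, and \<open>B\<close>
    bounds it.\<close>
  then have conv: "I \<longlonglongrightarrow> (SUP n. I n)"
    by (intro LIMSEQ_incseq_SUP) (auto simp: incseq_def I_mono)
  have "\<exists>g. g \<in> mid_hull h n \<and> J g < I n + 1 / Suc n" for n
  proof (rule ccontr)
    assume "\<not> ?thesis"
    then have "I n + 1 / Suc n \<le> I n"
      unfolding I_def[of n] by (intro cINF_greatest) (use ne in \<open>auto simp: I_def not_less\<close>)
    then show False by simp
  qed
  then obtain g where g: "\<And>n. g n \<in> mid_hull h n" "\<And>n. J (g n) < I n + 1 / Suc n"
    by metis
  \<comment> \<open>For n \<le> m both functions lie in the hull of the tail from n, hence so does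
    their midpoint, whose \<open>J\<close> is at least \<open>I n\<close>. The parallelogram law
    converts this into a bound on the distance.\<close>
  have diff: "(\<integral>x. (norm (snd (g n x) - snd (g m x)))\<^sup>2 \<partial>M) \<le> 2 * (I m - I n) + 4 * (1 / Suc n)" if "n \<le> m" for n m
  proof -
    have gm: "g m \<in> mid_hull h n"
      using mid_hull_antimono[OF that] g(1) by blast
    let ?d = "\<lambda>x. (norm (snd (g n x) - snd (g m x)))\<^sup>2"
    note [measurable] = sq(1)[OF g(1)]
    have "I n \<le> J (\<lambda>x. (1 / 2) *\<^sub>R (g n x + g m x))"
      using mid_hull.mid[OF g(1) gm] by (rule I_le)
    moreover have "integrable M ?d"
    proof (rule Bochner_Integration.integrable_bound)
      show "integrable M (\<lambda>x. 2 * (norm (snd (g n x)))\<^sup>2 + 2 * (norm (snd (g m x)))\<^sup>2)"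
        using sq(2)[OF g(1)] by auto
      have "?d x \<le> 2 * (norm (snd (g n x)))\<^sup>2 + 2 * (norm (snd (g m x)))\<^sup>2" for x
        using norm_mid_power2[of "snd (g n x)" "snd (g m x)"]
          zero_le_power2[of "norm ((1 / 2) *\<^sub>R (snd (g n x) + snd (g m x)))"] by linarith
      then show "AE x in M. norm (?d x) \<le> norm (2 * (norm (snd (g n x)))\<^sup>2 + 2 * (norm (snd (g m x)))\<^sup>2)"
        by (intro AE_I2) (simp add: abs_of_nonneg)
    qed measurable
    then have "J (\<lambda>x. (1 / 2) *\<^sub>R (g n x + g m x)) = J (g n) / 2 + J (g m) / 2 - (\<integral>x. ?d x \<partial>M) / 4"
      unfolding J_def snd_scaleR snd_add norm_mid_power2
      using sq(2)[OF g(1)] by simp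
    moreover define c d where "c = 1 / real (Suc n)" and "d = 1 / real (Suc m)"
    moreover have "d \<le> c"
      using that by (simp add: field_simps c_def d_def)
    moreover have "J (g n) < I n + c" "J (g m) < I m + d"
      using g(2) by (simp_all add: c_def d_def)
    \<comment> \<open>Here i, i' stand for \<open>I n\<close>, \<open>I m\<close>, then j for
      \<open>J\<close> of the midpoint, a, b for \<open>J (g n)\<close>, \<open>J (g m)\<close>, and
      q for the squared distance.\<close>
    moreover have "q \<le> 2 * (i' - i) + 4 * c"
      if "i \<le> j" "j = a / 2 + b / 2 - q / 4" "d \<le> c" "a < i + c" "b < i' + d" for i j a b q i' :: real
      using that by simp
    ultimately show ?thesis
      unfolding c_def[symmetric] by blast
  qed
  show ?thesis
  proof (rule that[OF g(1)])
    fix e :: real assume "e > 0"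
    \<comment> \<open>The tolerances fit \<open>diff\<close>: 2 (e/4) + 4 (e/8) = e.\<close>
    obtain N1 where N1: "\<And>m n. m \<ge> N1 \<Longrightarrow> n \<ge> N1 \<Longrightarrow> dist (I m) (I n) < e / 4"
      using metric_CauchyD[OF LIMSEQ_imp_Cauchy[OF conv], of "e / 4"] \<open>e > 0\<close> by auto
    obtain N2 where N2: "1 / real (Suc N2) < e / 8"
      using reals_Archimedean[of "e / 8"] \<open>e > 0\<close> by (auto simp: inverse_eq_divide)
    have *: "(\<integral>x. (norm (snd (g n x) - snd (g m x)))\<^sup>2 \<partial>M) \<le> e"
      if "n \<le> m" "n \<ge> max N1 N2" for n m
    proof -
      have "1 / real (Suc n) \<le> 1 / Suc N2"
        using that by (simp add: field_simps)
      moreover have "\<bar>I m - I n\<bar> < e / 4"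
        using N1[of m n] that by (simp add: dist_real_def)
      ultimately show ?thesis
        using diff[OF that(1)] N2 by argo
    qed
    show "\<exists>N. \<forall>m\<ge>N. \<forall>n\<ge>N. (\<integral>x. (norm (snd (g n x) - snd (g m x)))\<^sup>2 \<partial>M) \<le> e"
    proof (intro exI allI impI)
      fix m n assume "m \<ge> max N1 N2" "n \<ge> max N1 N2"
      then show "(\<integral>x. (norm (snd (g n x) - snd (g m x)))\<^sup>2 \<partial>M) \<le> e"
        using *[of n m] *[of m n] by (cases "n \<le> m") (auto simp: norm_minus_commute)
    qed
  qed
qed

text \<open>The increments are summable in L^1, hence almost everywhere, and \<open>W\<close> is the
  norm of the first term plus their sum. The weights (3/4)^k and (4/3)^k used below balance two
  demands: (3/4)^k must be summable, and so must (4/3)^k (1/4)^k = (1/3)^k.\<close>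

lemma fast_L2_Cauchy_AE_convergent:
  fixes f :: "nat \<Rightarrow> 'a \<Rightarrow> 'b::euclidean_space"
  assumes "finite_measure M"
    and [measurable]: "\<And>k. f k \<in> borel_measurable M"
    and f0: "integrable M (f 0)"
    and sq: "\<And>k. integrable M (\<lambda>x. (norm (f (Suc k) x - f k x))\<^sup>2)"
    and fast: "\<And>k. (\<integral>x. (norm (f (Suc k) x - f k x))\<^sup>2 \<partial>M) \<le> (1 / 4) ^ k"
  obtains W :: "'a \<Rightarrow> real" where "integrable M W" "AE x in M. \<forall>k. norm (f k x) \<le> W x"
    "AE x in M. (\<lambda>k. f k x) \<longlonglongrightarrow> lim (\<lambda>k. f k x)"
proof -
  interpret finite_measure M by fact
  let ?d = "\<lambda>k x. norm (f (Suc k) x - f k x)"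
  \<comment> \<open>AM-GM, in place of the Cauchy-Schwarz inequality\<close>
  have amgm: "?d k x \<le> ((3 / 4) ^ k + (4 / 3) ^ k * (?d k x)\<^sup>2) / 2" for k x
  proof -
    have "0 \<le> ((3 / 4) ^ k - ?d k x)\<^sup>2 * (4 / 3) ^ k"
      by simp
    also have "\<dots> = (3 / 4) ^ k * ((3 / 4) ^ k * (4 / 3) ^ k) - 2 * ?d k x * ((3 / 4) ^ k * (4 / 3) ^ k)
        + (4 / 3) ^ k * (?d k x)\<^sup>2"
      by (simp add: power2_eq_square algebra_simps)
    also have "(3 / 4 :: real) ^ k * (4 / 3) ^ k = 1"
      by (simp flip: power_mult_distrib)
    finally show ?thesis by simp
  qed
  have d_int: "integrable M (?d k)" for k
  proof (rule Bochner_Integration.integrable_bound)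
    show "integrable M (\<lambda>x. ((3 / 4) ^ k + (4 / 3) ^ k * (?d k x)\<^sup>2) / 2)"
      using sq[of k] by auto
    show "AE x in M. norm (?d k x) \<le> norm (((3 / 4) ^ k + (4 / 3) ^ k * (?d k x)\<^sup>2) / 2)"
      using amgm[of k] by (auto intro!: AE_I2 order_trans[OF _ abs_ge_self])
  qed measurable
  have d_le: "(\<integral>x. ?d k x \<partial>M) \<le> (measure M (space M) * (3 / 4) ^ k + (1 / 3) ^ k) / 2" for k
  proof -
    have "(\<integral>x. ?d k x \<partial>M) \<le> (\<integral>x. ((3 / 4) ^ k + (4 / 3) ^ k * (?d k x)\<^sup>2) / 2 \<partial>M)"
      using sq[of k] amgm[of k] d_int[of k] by (intro integral_mono) auto
    also have "\<dots> = (measure M (space M) * (3 / 4) ^ k + (4 / 3) ^ k * (\<integral>x. (?d k x)\<^sup>2 \<partial>M)) / 2"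
      using sq[of k] by simp
    also have "(4 / 3) ^ k * (\<integral>x. (?d k x)\<^sup>2 \<partial>M) \<le> (4 / 3) ^ k * (1 / 4) ^ k"
      by (intro mult_left_mono fast) auto
    also have "(4 / 3 :: real) ^ k * (1 / 4) ^ k = (1 / 3) ^ k"
      by (simp flip: power_mult_distrib)
    finally show ?thesis by simp
  qed
  have sum_d: "summable (\<lambda>k. \<integral>x. ?d k x \<partial>M)"
  proof (rule summable_comparison_test')
    show "summable (\<lambda>k. (measure M (space M) * (3 / 4) ^ k + (1 / 3) ^ k) / 2)"
      by (intro summable_divide summable_add summable_mult summable_geometric) auto
    show "norm (\<integral>x. ?d k x \<partial>M) \<le> (measure M (space M) * (3 / 4) ^ k + (1 / 3) ^ k) / 2" for k
      using d_le[of k] by simp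
  qed
  have ae: "AE x in M. summable (\<lambda>k. ?d k x)"
  proof -
    have "(\<integral>\<^sup>+x. (\<Sum>k. ennreal (?d k x)) \<partial>M) = (\<Sum>k. \<integral>\<^sup>+x. ennreal (?d k x) \<partial>M)"
      by (rule nn_integral_suminf) measurable
    also have "\<dots> = (\<Sum>k. ennreal (\<integral>x. ?d k x \<partial>M))"
      using d_int by (subst nn_integral_eq_integral) auto
    also have "\<dots> \<noteq> \<infinity>"
      using sum_d by (subst suminf_ennreal2) auto
    finally have "AE x in M. (\<Sum>k. ennreal (?d k x)) \<noteq> \<infinity>"
      by (intro nn_integral_PInf_AE) auto
    then show ?thesis
      by eventually_elim (auto intro: summable_suminf_not_top)
  qed
  define W where "W x = norm (f 0 x) + (\<Sum>k. ?d k x)" for x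
  have "integrable M (\<lambda>x. \<Sum>k. ?d k x)"
    by (rule integrable_suminf) (use d_int ae sum_d in auto)
  then have W: "integrable M W"
    unfolding W_def[abs_def] using f0 by auto
  have tel: "f k x = f 0 x + (\<Sum>j<k. f (Suc j) x - f j x)" for k x
    by (subst sum_lessThan_telescope) simp
  show ?thesis
  proof (rule that[OF W])
    show "AE x in M. \<forall>k. norm (f k x) \<le> W x"
      using ae
    proof eventually_elim
      case (elim x)
      show ?case
      proof
        fix k
        have "norm (f k x) \<le> norm (f 0 x) + norm (\<Sum>j<k. f (Suc j) x - f j x)"
          by (subst tel) (rule norm_triangle_ineq)
        also have "norm (\<Sum>j<k. f (Suc j) x - f j x) \<le> (\<Sum>j<k. ?d j x)"
          by (rule norm_sum)
        also have "(\<Sum>j<k. ?d j x) \<le> (\<Sum>j. ?d j x)"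
          by (rule sum_le_suminf) (use elim in auto)
        finally show "norm (f k x) \<le> W x"
          by (simp add: W_def)
      qed
    qed
    show "AE x in M. (\<lambda>k. f k x) \<longlonglongrightarrow> lim (\<lambda>k. f k x)"
      using ae
    proof eventually_elim
      case (elim x)
      then have "summable (\<lambda>j. f (Suc j) x - f j x)"
        by (rule summable_norm_cancel)
      then have "convergent (\<lambda>k. f 0 x + (\<Sum>j<k. f (Suc j) x - f j x))"
        by (intro convergent_add convergent_const) (simp add: summable_iff_convergent)
      then show ?case
        unfolding tel[symmetric] by (simp add: convergent_LIMSEQ_iff)
    qed
  qed
qed

text \<open>The limit of the averages comes with an integrable dominating function, as needed to
  pass to the limit in the integrals that define a weak gradient.\<close>

lemma mid_hull_AE_convergent:
  fixes h :: "nat \<Rightarrow> 'a \<Rightarrow> 'e::real_vector \<times> 'b::euclidean_space"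
  assumes M: "finite_measure M"
    and h: "\<And>k. (\<lambda>x. snd (h k x)) \<in> borel_measurable M"
    "\<And>k. integrable M (\<lambda>x. (norm (snd (h k x)))\<^sup>2)"
    and B: "\<And>k. (\<integral>x. (norm (snd (h k x)))\<^sup>2 \<partial>M) \<le> B"
  obtains g :: "nat \<Rightarrow> 'a \<Rightarrow> 'e \<times> 'b" and D :: "'a \<Rightarrow> 'b" and W :: "'a \<Rightarrow> real"
  where "\<And>n. g n \<in> mid_hull h n" "D \<in> borel_measurable M"
    "integrable M W" "AE x in M. \<forall>n. norm (snd (g n x)) \<le> W x"
    "AE x in M. (\<lambda>n. snd (g n x)) \<longlonglongrightarrow> D x"
proof -
  interpret finite_measure M by fact
  obtain g where g: "\<And>n. g n \<in> mid_hull h n"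
    and C: "\<And>e. e > 0 \<Longrightarrow> \<exists>N. \<forall>m\<ge>N. \<forall>n\<ge>N. (\<integral>x. (norm (snd (g n x) - snd (g m x)))\<^sup>2 \<partial>M) \<le> e"
    by (rule mid_hull_Cauchy[where h = h, OF h B]) blast
  note sq = mid_hull_square_integrable[OF h]
  have "\<forall>k. \<exists>N. \<forall>m\<ge>N. \<forall>n\<ge>N. (\<integral>x. (norm (snd (g n x) - snd (g m x)))\<^sup>2 \<partial>M) \<le> (1 / 4) ^ k"
    using C by simp
  then obtain N where N: "\<And>k m n. m \<ge> N k \<Longrightarrow> n \<ge> N k \<Longrightarrow>
      (\<integral>x. (norm (snd (g n x) - snd (g m x)))\<^sup>2 \<partial>M) \<le> (1 / 4) ^ k"
    by metis
  \<comment> \<open>The sum dominates \<open>N k\<close> at both k and \<open>Suc k\<close>; the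
    summand k keeps \<open>g (r k)\<close> in the hull of the tail from k.\<close>
  define r where "r k = (\<Sum>j\<le>k. N j) + k" for k
  have r: "r k \<ge> N k" "r (Suc k) \<ge> N k" "r k \<ge> k" for k
    using member_le_sum[of k "{..k}" N] by (auto simp: r_def)
  let ?f = "\<lambda>k x. snd (g (r k) x)"
  have [measurable]: "?f k \<in> borel_measurable M" for k
    using sq(1)[OF g] .
  have sqi: "integrable M (\<lambda>x. (norm (?f k x))\<^sup>2)" for k
    using sq(2)[OF g] .
  \<comment> \<open>On a finite measure space t \<le> 1 + t^2 passes from square integrable to
    integrable.\<close>
  have f0: "integrable M (?f 0)"
  proof (rule Bochner_Integration.integrable_bound)
    show "integrable M (\<lambda>x. 1 + (norm (?f 0 x))\<^sup>2)"
      using sqi by auto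
    show "AE x in M. norm (?f 0 x) \<le> norm (1 + (norm (?f 0 x))\<^sup>2)"
    proof (rule AE_I2)
      fix x
      show "norm (?f 0 x) \<le> norm (1 + (norm (?f 0 x))\<^sup>2)"
        using zero_le_power2[of "norm (?f 0 x) - 1"] norm_ge_zero[of "?f 0 x"]
        by (simp del: norm_ge_zero add: power2_eq_square algebra_simps)
    qed
  qed measurable
  have d: "integrable M (\<lambda>x. (norm (?f (Suc k) x - ?f k x))\<^sup>2)" for k
  proof (rule Bochner_Integration.integrable_bound)
    show "integrable M (\<lambda>x. 2 * (norm (?f (Suc k) x))\<^sup>2 + 2 * (norm (?f k x))\<^sup>2)"
      using sqi by auto
    have "(norm (?f (Suc k) x - ?f k x))\<^sup>2 \<le> 2 * (norm (?f (Suc k) x))\<^sup>2 + 2 * (norm (?f k x))\<^sup>2" for x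
      using norm_mid_power2[of "?f (Suc k) x" "?f k x"]
        zero_le_power2[of "norm ((1 / 2) *\<^sub>R (?f (Suc k) x + ?f k x))"] by linarith
    then show "AE x in M. norm ((norm (?f (Suc k) x - ?f k x))\<^sup>2)
        \<le> norm (2 * (norm (?f (Suc k) x))\<^sup>2 + 2 * (norm (?f k x))\<^sup>2)"
      by (intro AE_I2) (simp add: abs_of_nonneg)
  qed measurable
  obtain W where W: "integrable M W" "AE x in M. \<forall>k. norm (?f k x) \<le> W x"
    "AE x in M. (\<lambda>k. ?f k x) \<longlonglongrightarrow> lim (\<lambda>k. ?f k x)"
    by (rule fast_L2_Cauchy_AE_convergent[OF M _ f0 d N[OF r(1,2)]]) measurable
  have "g (r k) \<in> mid_hull h k" for k
    using g[of "r k"] mid_hull_antimono[OF r(3)[of k]] by blast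
  moreover have "(\<lambda>x. lim (\<lambda>k. ?f k x)) \<in> borel_measurable M"
    by measurable
  ultimately show ?thesis
    using that[of "\<lambda>k. g (r k)" "\<lambda>x. lim (\<lambda>k. ?f k x)" W] W by blast
qed

subsection \<open>Limits of weak gradients and of level convex functions\<close>

lemma pderivs_eq_0_outside:
  assumes "closed K" "\<And>x. x \<notin> K \<Longrightarrow> \<phi> x = 0" "x \<notin> K"
  shows "pderivs is \<phi> x = 0"
  using assms(3)
proof (induction "is" arbitrary: x)
  case (Cons i "is")
  have "((\<lambda>_. 0) has_derivative (\<lambda>_. 0)) (at x)" by simp
  then have "(pderivs is \<phi> has_derivative (\<lambda>_. 0)) (at x)"
    by (rule has_derivative_transform_within_open[where s = "- K"]) (use assms(1) Cons in auto)
  then show ?case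
    by (simp add: frechet_derivative_at[symmetric])
qed (use assms in simp)

lemma test_fun_pderivs:
  assumes "test_fun \<Omega> \<phi>"
  shows "continuous_on UNIV (pderivs is \<phi>)" "\<exists>c. \<forall>x. \<bar>pderivs is \<phi> x\<bar> \<le> c"
proof -
  from assms obtain K where K: "compact K" "\<And>x. x \<notin> K \<Longrightarrow> \<phi> x = 0"
    by (auto simp: test_fun_def)
  show cont: "continuous_on UNIV (pderivs is \<phi>)"
    using assms by (auto simp: test_fun_def smooth_fun_def continuous_on_eq_continuous_at
        intro: differentiable_imp_continuous_within)
  have "bounded (pderivs is \<phi> ` K)"
    using K(1) cont by (intro compact_imp_bounded compact_continuous_image)
      (auto intro: continuous_on_subset)
  then obtain c where "\<And>x. x \<in> K \<Longrightarrow> \<bar>pderivs is \<phi> x\<bar> \<le> c"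
    by (auto simp: bounded_iff)
  moreover have "pderivs is \<phi> x = 0" if "x \<notin> K" for x
    using pderivs_eq_0_outside[of K \<phi> x] compact_imp_closed[OF K(1)] K(2) that by blast
  ultimately have "\<bar>pderivs is \<phi> x\<bar> \<le> max c 0" for x
    by (cases "x \<in> K") (auto simp: max.coboundedI1)
  then show "\<exists>c. \<forall>x. \<bar>pderivs is \<phi> x\<bar> \<le> c" by blast
qed

lemma bounded_linear_column: "bounded_linear (column i :: real^'n^'m \<Rightarrow> real^'m)"
  unfolding linear_conv_bounded_linear[symmetric]
  by (rule linearI) (auto simp: column_def vec_eq_iff)

lemma weak_grad_mid:
  assumes "weak_grad \<Omega> u D" "weak_grad \<Omega> v E"
  shows "weak_grad \<Omega> (\<lambda>x. (1 / 2) *\<^sub>R (u x + v x)) (\<lambda>x. (1 / 2) *\<^sub>R (D x + E x))"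
proof -
  interpret column: bounded_linear "column i :: real^'a^'b \<Rightarrow> _" for i
    by (rule bounded_linear_column)
  show ?thesis
    unfolding weak_grad_def weak_partial_def
  proof (intro conjI allI impI)
    show "(\<lambda>x. (1 / 2) *\<^sub>R (D x + E x)) \<in> borel_measurable (lebesgue_on \<Omega>)"
      using assms by (auto simp: weak_grad_def intro!: borel_measurable_scaleR)
    fix i \<phi> assume \<phi>: "test_fun \<Omega> \<phi>"
    have half: "c *\<^sub>R (1 / 2) *\<^sub>R (a + b) = (1 / 2) *\<^sub>R (c *\<^sub>R a + c *\<^sub>R b)" for c and a b :: "real^'b"
      by (simp add: algebra_simps)
    have *: "integrable (lebesgue_on \<Omega>) (\<lambda>x. pderivs [i] \<phi> x *\<^sub>R u x)"
      "integrable (lebesgue_on \<Omega>) (\<lambda>x. pderivs [i] \<phi> x *\<^sub>R v x)"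
      "integrable (lebesgue_on \<Omega>) (\<lambda>x. \<phi> x *\<^sub>R column i (D x))"
      "integrable (lebesgue_on \<Omega>) (\<lambda>x. \<phi> x *\<^sub>R column i (E x))"
      "(\<integral>x. pderivs [i] \<phi> x *\<^sub>R u x \<partial>lebesgue_on \<Omega>) = - (\<integral>x. \<phi> x *\<^sub>R column i (D x) \<partial>lebesgue_on \<Omega>)"
      "(\<integral>x. pderivs [i] \<phi> x *\<^sub>R v x \<partial>lebesgue_on \<Omega>) = - (\<integral>x. \<phi> x *\<^sub>R column i (E x) \<partial>lebesgue_on \<Omega>)"
      using assms \<phi> unfolding weak_grad_def weak_partial_def by blast+
    show "integrable (lebesgue_on \<Omega>) (\<lambda>x. pderivs [i] \<phi> x *\<^sub>R (1 / 2) *\<^sub>R (u x + v x))"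
      "integrable (lebesgue_on \<Omega>) (\<lambda>x. \<phi> x *\<^sub>R column i ((1 / 2) *\<^sub>R (D x + E x)))"
      "(\<integral>x. pderivs [i] \<phi> x *\<^sub>R (1 / 2) *\<^sub>R (u x + v x) \<partial>lebesgue_on \<Omega>)
        = - (\<integral>x. \<phi> x *\<^sub>R column i ((1 / 2) *\<^sub>R (D x + E x)) \<partial>lebesgue_on \<Omega>)"
      unfolding column.scaleR column.add half
      unfolding integral_scaleR_right Bochner_Integration.integral_add[OF *(1,2)]
        Bochner_Integration.integral_add[OF *(3,4)] *(5,6)
      by (intro integrable_scaleR_right Bochner_Integration.integrable_add *)+
        (simp add: algebra_simps)
  qed
qed

text \<open>Both sides of the integration by parts formula converge by dominated convergence: the
  function side is bounded by a constant on a set of finite measure, the gradient side by a multiple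
  of \<open>W\<close>.\<close>

lemma weak_grad_limit:
  fixes u :: "real^'n::finite \<Rightarrow> real^'d::finite"
  assumes \<Omega>: "\<Omega> \<in> lmeasurable"
    and wg: "\<And>k. weak_grad \<Omega> (v k) (E k)"
    and u: "u \<in> borel_measurable (lebesgue_on \<Omega>)"
    and vC: "\<And>k. AE x in lebesgue_on \<Omega>. norm (v k x) \<le> C"
    and vu: "AE x in lebesgue_on \<Omega>. (\<lambda>k. v k x) \<longlonglongrightarrow> u x"
    and D: "D \<in> borel_measurable (lebesgue_on \<Omega>)"
    and W: "integrable (lebesgue_on \<Omega>) W" "AE x in lebesgue_on \<Omega>. \<forall>k. norm (E k x) \<le> W x"
    and ED: "AE x in lebesgue_on \<Omega>. (\<lambda>k. E k x) \<longlonglongrightarrow> D x"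
  shows "weak_grad \<Omega> u D"
proof -
  interpret finite_measure "lebesgue_on \<Omega>"
    by (rule finite_measure_lebesgue_on[OF \<Omega>])
  interpret column: bounded_linear "column i :: real^'n^'d \<Rightarrow> _" for i
    by (rule bounded_linear_column)
  have col[measurable]: "column i \<in> borel_measurable (borel :: (real^'n^'d) measure)" for i
    by (intro borel_measurable_continuous_onI column.continuous_on continuous_on_id)
  note D[measurable] u[measurable]
  have "weak_partial \<Omega> u i (\<lambda>x. column i (D x))" for i
    unfolding weak_partial_def
  proof (intro allI impI)
    fix \<phi> assume \<phi>: "test_fun \<Omega> \<phi>"
    let ?d = "pderivs [i] \<phi>"
    have cont: "continuous_on UNIV ?d" "continuous_on UNIV \<phi>"
      using test_fun_pderivs(1)[OF \<phi>, of "[i]"] test_fun_pderivs(1)[OF \<phi>, of "[]"] by auto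
    obtain c c' where c: "\<And>x. \<bar>?d x\<bar> \<le> c" and c': "\<And>x. \<bar>\<phi> x\<bar> \<le> c'"
      using test_fun_pderivs(2)[OF \<phi>, of "[i]"] test_fun_pderivs(2)[OF \<phi>, of "[]"] by auto
    have [measurable]: "?d \<in> borel_measurable (lebesgue_on \<Omega>)" "\<phi> \<in> borel_measurable (lebesgue_on \<Omega>)"
      using \<Omega> by (auto intro!: continuous_imp_measurable_on_sets_lebesgue
          intro: continuous_on_subset[OF cont(1)] continuous_on_subset[OF cont(2)] simp del: pderivs.simps)
    have k: "integrable (lebesgue_on \<Omega>) (\<lambda>x. ?d x *\<^sub>R v k x)"
        "integrable (lebesgue_on \<Omega>) (\<lambda>x. \<phi> x *\<^sub>R column i (E k x))"
        "(\<integral>x. ?d x *\<^sub>R v k x \<partial>lebesgue_on \<Omega>) = - (\<integral>x. \<phi> x *\<^sub>R column i (E k x) \<partial>lebesgue_on \<Omega>)" for k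
      using wg[of k] \<phi> by (auto simp: weak_grad_def weak_partial_def simp del: pderivs.simps)
    have lim1: "AE x in lebesgue_on \<Omega>. (\<lambda>k. ?d x *\<^sub>R v k x) \<longlonglongrightarrow> ?d x *\<^sub>R u x"
      using vu by eventually_elim (intro tendsto_intros)
    have bnd1: "AE x in lebesgue_on \<Omega>. norm (?d x *\<^sub>R v k x) \<le> c * C" for k
      using vC[of k]
    proof eventually_elim
      case (elim x)
      then show ?case
        using mult_mono[OF c[of x] elim] order_trans[OF abs_ge_zero c[of x]]
        by (simp del: pderivs.simps)
    qed
    have I1: "integrable (lebesgue_on \<Omega>) (\<lambda>x. ?d x *\<^sub>R u x)"
      by (rule integrable_dominated_convergence[OF _ _ _ lim1 bnd1]) (use k(1) in \<open>auto simp del: pderivs.simps\<close>)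
    have L1: "(\<lambda>k. \<integral>x. ?d x *\<^sub>R v k x \<partial>lebesgue_on \<Omega>) \<longlonglongrightarrow> (\<integral>x. ?d x *\<^sub>R u x \<partial>lebesgue_on \<Omega>)"
      by (rule integral_dominated_convergence[OF _ _ _ lim1 bnd1]) (use k(1) in \<open>auto simp del: pderivs.simps\<close>)
    have lim2: "AE x in lebesgue_on \<Omega>. (\<lambda>k. \<phi> x *\<^sub>R column i (E k x)) \<longlonglongrightarrow> \<phi> x *\<^sub>R column i (D x)"
      using ED by eventually_elim (intro tendsto_intros column.tendsto)
    obtain K where K: "K > 0" "\<And>A :: real^'n^'d. norm (column i A) \<le> norm A * K"
      using column.pos_bounded by blast
    have bnd2: "AE x in lebesgue_on \<Omega>. norm (\<phi> x *\<^sub>R column i (E k x)) \<le> c' * (W x * K)" for k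
      using W(2)
    proof eventually_elim
      case (elim x)
      have "norm (column i (E k x)) \<le> W x * K"
        using K(2)[of "E k x"] elim K(1) by (meson mult_right_mono less_imp_le order_trans)
      then show ?case
        using mult_mono[OF c'[of x], of "norm (column i (E k x))"] order_trans[OF abs_ge_zero c'[of x]]
        by simp
    qed
    have W': "integrable (lebesgue_on \<Omega>) (\<lambda>x. c' * (W x * K))"
      using W(1) by auto
    have I2: "integrable (lebesgue_on \<Omega>) (\<lambda>x. \<phi> x *\<^sub>R column i (D x))"
      by (rule integrable_dominated_convergence[OF _ _ W' lim2 bnd2]) (use k(2) in auto)
    have L2: "(\<lambda>k. \<integral>x. \<phi> x *\<^sub>R column i (E k x) \<partial>lebesgue_on \<Omega>) \<longlonglongrightarrow> (\<integral>x. \<phi> x *\<^sub>R column i (D x) \<partial>lebesgue_on \<Omega>)"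
      by (rule integral_dominated_convergence[OF _ _ W' lim2 bnd2]) (use k(2) in auto)
    have "(\<integral>x. ?d x *\<^sub>R u x \<partial>lebesgue_on \<Omega>) = - (\<integral>x. \<phi> x *\<^sub>R column i (D x) \<partial>lebesgue_on \<Omega>)"
      by (rule LIMSEQ_unique[OF L1]) (use tendsto_minus[OF L2] k(3) in \<open>simp del: pderivs.simps\<close>)
    with I1 I2 show "integrable (lebesgue_on \<Omega>) (\<lambda>x. ?d x *\<^sub>R u x) \<and>
        integrable (lebesgue_on \<Omega>) (\<lambda>x. \<phi> x *\<^sub>R column i (D x)) \<and>
        (\<integral>x. ?d x *\<^sub>R u x \<partial>lebesgue_on \<Omega>) = - (\<integral>x. \<phi> x *\<^sub>R column i (D x) \<partial>lebesgue_on \<Omega>)"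
      by blast
  qed
  with D show ?thesis by (auto simp: weak_grad_def)
qed

text \<open>Joint lower semicontinuity puts every limit point of \<open>\<xi>\<close> into the
  closed convex set K = {F a \<le> 1}. Boundedness then forces \<open>\<xi>\<close> eventually into
  any given neighbourhood of K. Such a neighbourhood is convex, so it also contains the averages
  \<open>g n\<close>, and their limit lies in K.\<close>

lemma lsc_level_convex_limit:
  fixes F :: "'u::metric_space \<Rightarrow> 'x::euclidean_space \<Rightarrow> real"
  assumes lsc: "lsc (\<lambda>(u, \<xi>). F u \<xi>)"
    and lc: "level_convex (F a)"
    and u: "u \<longlonglongrightarrow> a"
    and R: "\<forall>\<^sub>F j in sequentially. norm (\<xi> j) \<le> R"
    and F: "\<And>e. e > 0 \<Longrightarrow> \<forall>\<^sub>F j in sequentially. F (u j) (\<xi> j) \<le> 1 + e"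
    and hull: "\<And>K n. convex K \<Longrightarrow> (\<And>j. j \<ge> n \<Longrightarrow> \<xi> j \<in> K) \<Longrightarrow> g n \<in> K"
    and g: "g \<longlonglongrightarrow> D"
  shows "F a D \<le> 1"
proof -
  define K where "K = {\<xi>. F a \<xi> \<le> 1}"
  have lsc': "\<forall>\<^sub>F w in nhds z. c < (case w of (u, \<xi>) \<Rightarrow> F u \<xi>)" if "c < (case z of (u, \<xi>) \<Rightarrow> F u \<xi>)" for c z
    using lsc that unfolding lsc_def by blast
  have convex: "convex K"
    using lc by (simp add: K_def level_convex_def)
  have limit_point: "l \<in> K" if r: "strict_mono r" and l: "(\<xi> \<circ> r) \<longlonglongrightarrow> l" for r l
  proof (rule ccontr)
    assume "l \<notin> K"
    then have "1 < F a l" by (simp add: K_def)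
    then obtain c where c: "1 < c" "c < F a l" using dense by blast
    have "(\<lambda>j. (u (r j), \<xi> (r j))) \<longlonglongrightarrow> (a, l)"
      using LIMSEQ_subseq_LIMSEQ[OF u r] l by (intro tendsto_Pair) (auto simp: o_def)
    with lsc'[of c "(a, l)"] c(2) have "\<forall>\<^sub>F j in sequentially. c < F (u (r j)) (\<xi> (r j))"
      unfolding filterlim_iff by fastforce
    \<comment> \<open>The bound c is written as 1 + (c - 1) to fit the hypothesis
      \<open>F\<close>.\<close>
    moreover have "\<forall>\<^sub>F j in sequentially. F (u (r j)) (\<xi> (r j)) \<le> 1 + (c - 1)"
      using eventually_subseq[OF r F[of "c - 1"]] c(1) by simp
    ultimately have "\<forall>\<^sub>F j::nat in sequentially. False"
      by eventually_elim simp
    then show False by simp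
  qed
  have closed: "closed K"
  proof -
    have "open (- K)"
    proof (subst open_subopen, safe)
      fix x assume "x \<notin> K"
      then have "\<forall>\<^sub>F w in nhds (a, x). 1 < (case w of (u, \<xi>) \<Rightarrow> F u \<xi>)"
        by (intro lsc') (auto simp: K_def)
      moreover have "((\<lambda>y. (a, y)) \<longlongrightarrow> (a, x)) (nhds x)"
        by (intro tendsto_Pair tendsto_const filterlim_ident)
      ultimately have "\<forall>\<^sub>F y in nhds x. 1 < F a y"
        unfolding filterlim_iff by fastforce
      then show "\<exists>T. open T \<and> x \<in> T \<and> T \<subseteq> - K"
        by (fastforce simp: eventually_nhds K_def)
    qed
    then show ?thesis by (simp add: closed_def)
  qed
  have "D \<in> closure K"
    unfolding closure_approachable
  proof (intro allI impI)
    fix e :: real assume "e > 0"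
    define d where "d = e / 2"
    have d: "d > 0" using \<open>e > 0\<close> by (simp add: d_def)
    \<comment> \<open>The open d-neighbourhood of K, as a Minkowski sum so that its convexity is
      that of K and the ball.\<close>
    define N where "N = (\<Union>x\<in>K. \<Union>y\<in>ball 0 d. {x + y})"
    have N: "convex N"
      unfolding N_def by (intro convex_sums convex convex_ball)
    have mem_N: "y \<in> N \<longleftrightarrow> (\<exists>x\<in>K. dist y x < d)" for y
    proof
      assume "\<exists>x\<in>K. dist y x < d"
      then obtain x where "x \<in> K" "dist y x < d" by blast
      then show "y \<in> N"
        unfolding N_def by (intro UN_I[of x] UN_I[of "y - x"]) (auto simp: dist_norm norm_minus_commute)
    next
      assume "y \<in> N"
      then obtain x b where "x \<in> K" "norm b < d" "y = x + b"
        by (auto simp: N_def)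
      then show "\<exists>x\<in>K. dist y x < d"
        by (intro bexI[of _ x]) (simp_all add: dist_norm)
    qed
    \<comment> \<open>Otherwise infinitely many bounded terms avoid N; they have a limit point,
      which lies in K yet stays at distance at least d from it.\<close>
    have "\<forall>\<^sub>F j in sequentially. \<xi> j \<in> N"
    proof (rule ccontr)
      assume "\<not> ?thesis"
      then have "\<exists>\<^sub>F j in sequentially. \<xi> j \<notin> N \<and> norm (\<xi> j) \<le> R"
        using R by (simp add: not_eventually frequently_eventually_frequently)
      then have "infinite {j. \<xi> j \<notin> N \<and> norm (\<xi> j) \<le> R}"
        by (simp add: frequently_cofinite flip: cofinite_eq_sequentially)
      then obtain r :: "nat \<Rightarrow> nat" where r: "strict_mono r" "\<And>j. \<xi> (r j) \<notin> N" "\<And>j. norm (\<xi> (r j)) \<le> R"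
        using infinite_enumerate by blast
      have "\<exists>l. \<exists>s. strict_mono s \<and> ((\<xi> \<circ> r) \<circ> s) \<longlonglongrightarrow> l"
        by (rule bounded_imp_convergent_subsequence) (use r(3) in \<open>auto simp: bounded_iff\<close>)
      then obtain l s where s: "strict_mono s" "((\<xi> \<circ> r) \<circ> s) \<longlonglongrightarrow> l"
        by blast
      have "l \<in> K"
        using s r(1) by (intro limit_point[of "r \<circ> s"]) (auto simp: o_assoc strict_mono_o)
      from metric_LIMSEQ_D[OF s(2) d] obtain j where "dist (\<xi> (r (s j))) l < d"
        by auto
      with \<open>l \<in> K\<close> r(2) show False by (auto simp: mem_N)
    qed
    then obtain n where n: "\<And>j. j \<ge> n \<Longrightarrow> \<xi> j \<in> N"
      by (auto simp: eventually_sequentially)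
    obtain m where m: "\<And>j. j \<ge> m \<Longrightarrow> dist (g j) D < d"
      using metric_LIMSEQ_D[OF g d] by blast
    have "g (max m n) \<in> N"
      by (rule hull[OF N]) (use n in auto)
    then obtain x where "x \<in> K" "dist (g (max m n)) x < d"
      by (auto simp: mem_N)
    then have "dist x D < e"
      using m[of "max m n"] dist_triangle[of x D "g (max m n)"] by (simp add: d_def dist_commute)
    with \<open>x \<in> K\<close> show "\<exists>y\<in>K. dist y D < e" by blast
  qed
  with closed show ?thesis by (simp add: K_def)
qed

section \<open>Pointwise inequalities for the energy density\<close>

text \<open>Exponential growth beats linear growth: this absorbs the factor 1/p of the
  energy.\<close>

lemma powr_ge_times_ln:
  fixes a p :: real
  assumes "a > 1"
  shows "p * ln a \<le> a powr p"
proof -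
  have "p * ln a \<le> exp (p * ln a)"
    using exp_ge_add_one_self[of "p * ln a"] by linarith
  then show ?thesis using assms by (simp add: powr_def)
qed

text \<open>Split s^p into two copies of (sqrt s)^p. One is at least (sqrt s)^k, the other pays for
  the factor 1/p.\<close>

lemma powr_energy_ge:
  fixes s p F :: real
  assumes "s > 1" "real k \<le> p" "s \<le> F" "p > 0"
  shows "sqrt s ^ k * ln (sqrt s) \<le> 1 / p * F powr p"
proof -
  let ?a = "sqrt s"
  have a: "?a > 1" using assms by simp
  have "sqrt s ^ k * (p * ln (sqrt s)) \<le> ?a powr p * ?a powr p"
    using a assms powr_mono[of "real k" p ?a]
    by (intro mult_mono powr_ge_times_ln) (auto simp: powr_realpow)
  also have "\<dots> = s powr p"
    using assms by (simp flip: powr_mult)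
  also have "\<dots> \<le> F powr p"
    using assms by (intro powr_mono2) auto
  finally show ?thesis using assms by (simp add: field_simps)
qed

text \<open>Coercivity gives t^2 \<le> (F/\<alpha>)^(2/\<gamma>), so only large F needs the energy.
  There F^p splits into two copies of F^(p/2): since p/2 \<ge> 2/\<gamma>, one dominates
  F^(2/\<gamma>), and the other exceeds (p/2) ln 2. This is the origin of the threshold
  4/\<gamma>.\<close>

lemma square_le_energy:
  fixes \<alpha> \<gamma> p t F :: real
  assumes "\<alpha> > 0" "\<gamma> > 0" "4 / \<gamma> \<le> p" "p > 0" "t \<ge> 0" and F: "\<alpha> * t powr \<gamma> \<le> F"
  shows "t\<^sup>2 \<le> (2 / \<alpha>) powr (2 / \<gamma>) + 2 / ln 2 * \<alpha> powr (- (2 / \<gamma>)) * (1 / p * F powr p)"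
proof (cases "t = 0")
  case False
  then have t: "t > 0" using \<open>t \<ge> 0\<close> by linarith
  have sq: "t\<^sup>2 \<le> (c / \<alpha>) powr (2 / \<gamma>)" if "F \<le> c" for c
  proof -
    have "t\<^sup>2 = (t powr \<gamma>) powr (2 / \<gamma>)"
      using t assms by (simp add: powr_powr powr_numeral)
    also have "\<dots> \<le> (c / \<alpha>) powr (2 / \<gamma>)"
      using that F assms by (intro powr_mono2) (auto simp: field_simps)
    finally show ?thesis .
  qed
  show ?thesis
  proof (cases "F \<le> 2")
    case True
    with assms show ?thesis by (intro order_trans[OF sq[OF True]]) auto
  next
    case F2: False
    have "F powr (2 / \<gamma>) * (p / 2 * ln 2) \<le> F powr (p / 2) * F powr (p / 2)"
    proof (intro mult_mono)
      show "F powr (2 / \<gamma>) \<le> F powr (p / 2)"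
        using F2 assms by (intro powr_mono) auto
      have "p / 2 * ln 2 \<le> 2 powr (p / 2)"
        by (rule powr_ge_times_ln) simp
      also have "\<dots> \<le> F powr (p / 2)"
        using F2 assms by (intro powr_mono2) auto
      finally show "p / 2 * ln 2 \<le> F powr (p / 2)" .
    qed (use assms in auto)
    then have "F powr (2 / \<gamma>) * (p / 2 * ln 2) \<le> F powr p"
      by (simp flip: powr_add)
    then have *: "F powr (2 / \<gamma>) \<le> 2 / ln 2 * (1 / p * F powr p)"
      using assms by (simp add: field_simps)
    have "t\<^sup>2 \<le> (F / \<alpha>) powr (2 / \<gamma>)"
      by (rule sq) simp
    also have "\<dots> = \<alpha> powr (- (2 / \<gamma>)) * F powr (2 / \<gamma>)"
      using F2 assms by (simp add: powr_divide powr_minus field_simps)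
    also have "\<dots> \<le> \<alpha> powr (- (2 / \<gamma>)) * (2 / ln 2 * (1 / p * F powr p))"
      by (intro mult_left_mono *) auto
    finally show ?thesis
      using assms by (intro order_trans[OF _ add_increasing[OF _ order_refl]]) (auto simp: mult_ac)
  qed
qed (use assms in auto)

subsection \<open>The lower bound\<close>

lemma le_powr_inverse_exponent:
  fixes \<alpha> \<gamma> t c :: real
  assumes "\<alpha> > 0" "\<gamma> > 0" "t \<ge> 0" "\<alpha> * t powr \<gamma> \<le> c"
  shows "t \<le> (c / \<alpha>) powr (1 / \<gamma>)"
proof (cases "t = 0")
  case False
  then have "t = (t powr \<gamma>) powr (1 / \<gamma>)"
    using assms by (simp add: powr_powr)
  also have "\<dots> \<le> (c / \<alpha>) powr (1 / \<gamma>)"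
    using assms by (intro powr_mono2) (auto simp: field_simps)
  finally show ?thesis .
qed simp

text \<open>Exponents of size at least k + 1 make the measures of the sets where
  \<open>\<phi> k\<close> exceeds s > 1 decay geometrically, hence summably. This dictates the
  growth required of the subsequence; the extra 1 keeps the exponent positive at k = 0.\<close>

lemma energy_bound_imp_AE_eventually_le:
  fixes \<phi> q :: "nat \<Rightarrow> 'a \<Rightarrow> real"
  assumes "finite_measure M"
    and [measurable]: "\<And>k. \<phi> k \<in> borel_measurable M" "\<And>k. q k \<in> borel_measurable M"
    and q: "\<And>k. AE x in M. real k + 1 \<le> q k x"
    and energy: "\<And>k. (\<integral>\<^sup>+x. ennreal (1 / q k x * \<phi> k x powr q k x) \<partial>M) \<le> ennreal C"
    and "C \<ge> 0"
  shows "AE x in M. \<forall>e>0. \<forall>\<^sub>F k in sequentially. \<phi> k x \<le> 1 + e"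
proof -
  interpret finite_measure M by fact
  have *: "AE x in M. \<forall>\<^sub>F k in sequentially. \<phi> k x \<le> s" if "s > 1" for s
  proof -
    define A where "A k = {x \<in> space M. s < \<phi> k x}" for k
    \<comment> \<open>By \<open>powr_energy_ge\<close> the energy density is at least
      \<open>c k\<close> on \<open>A k\<close>, so \<open>A k\<close> has measure at most C / c k,
      geometric with ratio 1 / sqrt s.\<close>
    define c where "c k = sqrt s ^ k * ln (sqrt s)" for k
    have [measurable]: "A k \<in> sets M" for k
      unfolding A_def by measurable
    have c: "c k > 0" for k using that by (simp add: c_def)
    have le: "measure M (A k) \<le> C / ln (sqrt s) * (1 / sqrt s) ^ k" for k
    proof -
      have "ennreal (c k * measure M (A k)) = ennreal (c k) * emeasure M (A k)"
        using c[of k] by (simp add: emeasure_eq_measure ennreal_mult)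
      also have "\<dots> = (\<integral>\<^sup>+x. ennreal (c k) * indicator (A k) x \<partial>M)"
        by (simp add: nn_integral_cmult_indicator)
      also have "\<dots> \<le> (\<integral>\<^sup>+x. ennreal (1 / q k x * \<phi> k x powr q k x) \<partial>M)"
      proof (rule nn_integral_mono_AE)
        show "AE x in M. ennreal (c k) * indicator (A k) x \<le> ennreal (1 / q k x * \<phi> k x powr q k x)"
          using q[of k]
        proof eventually_elim
          case (elim x)
          then show ?case
            using powr_energy_ge[OF that, of k "q k x" "\<phi> k x"]
            by (auto simp: indicator_def A_def c_def intro!: ennreal_leI)
        qed
      qed
      also have "\<dots> \<le> ennreal C" by (rule energy)
      finally have "c k * measure M (A k) \<le> C"
        using \<open>C \<ge> 0\<close> by simp
      then have "measure M (A k) \<le> C / c k"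
        using c[of k] by (simp add: field_simps)
      then show ?thesis
        by (simp add: c_def power_divide field_simps)
    qed
    have "summable (\<lambda>k. measure M (A k))"
    proof (rule summable_comparison_test')
      show "summable (\<lambda>k. C / ln (sqrt s) * (1 / sqrt s) ^ k)"
        using that by (intro summable_mult summable_geometric) auto
      show "norm (measure M (A k)) \<le> C / ln (sqrt s) * (1 / sqrt s) ^ k" for k
        using le[of k] by simp
    qed
    then have "AE x in M. \<forall>\<^sub>F k in sequentially. x \<in> space M - A k"
      by (intro borel_cantelli_AE1) (auto simp: emeasure_eq_measure)
    then show ?thesis
      by eventually_elim (auto simp: A_def not_less elim: eventually_mono)
  qed
  \<comment> \<open>The exceptional null set depends on the level s, so the levels are restricted to
    a countable sequence tending to 1.\<close>
  have "AE x in M. \<forall>m. \<forall>\<^sub>F k in sequentially. \<phi> k x \<le> 1 + 1 / Suc m"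
    unfolding AE_all_countable by (intro allI *) simp
  then show ?thesis
  proof eventually_elim
    case (elim x)
    show ?case
    proof (intro allI impI)
      fix e :: real assume "e > 0"
      then obtain m where "1 / real (Suc m) < e"
        using reals_Archimedean[of e] by (auto simp: inverse_eq_divide)
      with elim[rule_format, of m] show "\<forall>\<^sub>F k in sequentially. \<phi> k x \<le> 1 + e"
        by (auto elim!: eventually_mono)
    qed
  qed
qed

text \<open>The integrated form of \<open>square_le_energy\<close>. Its bound is independent of the
  exponent, hence uniform along the subsequence.\<close>

lemma energy_bound_imp_square_integrable:
  fixes D :: "'a \<Rightarrow> 'b::euclidean_space" and \<phi> q :: "'a \<Rightarrow> real"
  assumes "finite_measure M" "\<alpha> > 0" "\<gamma> > 0"
    and [measurable]: "D \<in> borel_measurable M" "\<phi> \<in> borel_measurable M" "q \<in> borel_measurable M"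
    and q: "AE x in M. 4 / \<gamma> \<le> q x"
    and coercive: "AE x in M. \<alpha> * norm (D x) powr \<gamma> \<le> \<phi> x"
    and energy: "(\<integral>\<^sup>+x. ennreal (1 / q x * \<phi> x powr q x) \<partial>M) \<le> ennreal C"
    and "C \<ge> 0"
  shows "integrable M (\<lambda>x. (norm (D x))\<^sup>2)"
    and "(\<integral>x. (norm (D x))\<^sup>2 \<partial>M)
      \<le> (2 / \<alpha>) powr (2 / \<gamma>) * measure M (space M) + 2 / ln 2 * \<alpha> powr (- (2 / \<gamma>)) * C"
proof -
  interpret finite_measure M by fact
  define A where "A = (2 / \<alpha>) powr (2 / \<gamma>)"
  define c where "c = 2 / ln 2 * \<alpha> powr (- (2 / \<gamma>))"
  have nonneg: "A \<ge> 0" "c \<ge> 0" by (auto simp: A_def c_def)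
  have "(\<integral>\<^sup>+x. ennreal ((norm (D x))\<^sup>2) \<partial>M)
      \<le> (\<integral>\<^sup>+x. ennreal A + ennreal c * ennreal (1 / q x * \<phi> x powr q x) \<partial>M)"
  proof (rule nn_integral_mono_AE)
    show "AE x in M. ennreal ((norm (D x))\<^sup>2)
        \<le> ennreal A + ennreal c * ennreal (1 / q x * \<phi> x powr q x)"
      using q coercive
    proof eventually_elim
      case (elim x)
      have q0: "q x > 0"
        using elim(1) \<open>\<gamma> > 0\<close> by (meson divide_pos_pos less_le_trans zero_less_numeral)
      have "(norm (D x))\<^sup>2 \<le> A + c * (1 / q x * \<phi> x powr q x)"
        unfolding A_def c_def using elim assms(2,3) q0 by (intro square_le_energy) auto
      then have "ennreal ((norm (D x))\<^sup>2) \<le> ennreal (A + c * (1 / q x * \<phi> x powr q x))"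
        by (rule ennreal_leI)
      also have "\<dots> = ennreal A + ennreal c * ennreal (1 / q x * \<phi> x powr q x)"
        using nonneg q0 by (subst ennreal_plus) (auto simp flip: ennreal_mult)
      finally show ?case .
    qed
  qed
  also have "\<dots> = ennreal A * emeasure M (space M)
      + ennreal c * (\<integral>\<^sup>+x. ennreal (1 / q x * \<phi> x powr q x) \<partial>M)"
    by (simp add: nn_integral_add nn_integral_cmult)
  also have "\<dots> \<le> ennreal A * emeasure M (space M) + ennreal c * ennreal C"
    by (intro add_left_mono mult_left_mono energy) simp
  also have "\<dots> = ennreal (A * measure M (space M) + c * C)"
    using nonneg \<open>C \<ge> 0\<close> by (simp add: emeasure_eq_measure ennreal_mult ennreal_plus)
  finally have le: "(\<integral>\<^sup>+x. ennreal ((norm (D x))\<^sup>2) \<partial>M) \<le> ennreal (A * measure M (space M) + c * C)" .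
  then show "integrable M (\<lambda>x. (norm (D x))\<^sup>2)"
    by (intro integrableI_bounded) (auto intro: le_less_trans)
  show "(\<integral>x. (norm (D x))\<^sup>2 \<partial>M)
      \<le> (2 / \<alpha>) powr (2 / \<gamma>) * measure M (space M) + 2 / ln 2 * \<alpha> powr (- (2 / \<gamma>)) * C"
    using le nonneg \<open>C \<ge> 0\<close> unfolding A_def[symmetric] c_def[symmetric]
    by (subst integral_eq_nn_integral) (auto intro!: enn2real_leI)
qed

section \<open>From bounded energies to the constraint on the limit\<close>

text \<open>One null set serves all m and k, so that the bounds can be handed to averages point by
  point.\<close>

lemma Linf_conv_AE_uniform:
  assumes "Linf_conv \<Omega> us u"
  obtains N where "AE x in lebesgue_on \<Omega>. \<forall>m k. N m \<le> k \<longrightarrow> norm (us k x - u x) \<le> 1 / real (Suc m)"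
proof -
  have "\<forall>m. \<exists>N. \<forall>k\<ge>N. AE x in lebesgue_on \<Omega>. norm (us k x - u x) \<le> 1 / real (Suc m)"
    using assms by (auto simp: Linf_conv_def eventually_sequentially)
  then obtain N where "\<And>m k. N m \<le> k \<Longrightarrow> AE x in lebesgue_on \<Omega>. norm (us k x - u x) \<le> 1 / real (Suc m)"
    by metis
  then have "AE x in lebesgue_on \<Omega>. \<forall>m k. N m \<le> k \<longrightarrow> norm (us k x - u x) \<le> 1 / real (Suc m)"
    unfolding AE_all_countable by simp
  then show ?thesis by (rule that)
qed

lemma LIMSEQ_if_eventually_le_inverse_Suc:
  fixes a :: "nat \<Rightarrow> 'a::real_normed_vector"
  assumes "\<And>m k. N m \<le> k \<Longrightarrow> norm (a k - l) \<le> 1 / real (Suc m)"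
  shows "a \<longlonglongrightarrow> l"
proof (rule metric_LIMSEQ_I)
  fix e :: real assume "e > 0"
  then obtain m where "1 / real (Suc m) < e"
    using reals_Archimedean[of e] by (auto simp: inverse_eq_divide)
  with assms[of m] show "\<exists>no. \<forall>k\<ge>no. dist (a k) l < e"
    by (intro exI[of _ "N m"]) (auto simp: dist_norm intro: le_less_trans)
qed

text \<open>In the lower bound on \<open>q k\<close>, the part k + 1 feeds the Borel-Cantelli
  argument and 4/\<gamma> the L^2 estimate. The averaged limit \<open>D\<close> is itself the
  gradient whose existence \<open>F_lim\<close> demands.\<close>

lemma bounded_energy_imp_F_lim_eq_0:
  fixes \<Omega> :: "(real^'n::finite) set"
    and f :: "real^'n \<Rightarrow> real^'d::finite \<Rightarrow> real^'n^'d \<Rightarrow> real"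
  assumes \<Omega>: "\<Omega> \<in> lmeasurable"
    and normal: "normal_integrand \<Omega> f"
    and H1: "AE x in lebesgue_on \<Omega>. \<forall>u. level_convex (f x u)"
    and "\<alpha> > 0" "\<gamma> > 0"
    and H2: "AE x in lebesgue_on \<Omega>. \<forall>u \<xi>. f x u \<xi> \<ge> \<alpha> * norm \<xi> powr \<gamma>"
    and u: "Linf \<Omega> u" and us: "\<And>k. Linf \<Omega> (us k)" and conv: "Linf_conv \<Omega> us u"
    and wg: "\<And>k. weak_grad \<Omega> (us k) (Du k)"
    and q[measurable]: "\<And>k. q k \<in> borel_measurable (lebesgue_on \<Omega>)"
    and q_ge: "\<And>k. AE x in lebesgue_on \<Omega>. real k + 1 + 4 / \<gamma> \<le> q k x"
    and energy: "\<And>k. (\<integral>\<^sup>+x. ennreal (1 / q k x * f x (us k x) (Du k x) powr q k x) \<partial>lebesgue_on \<Omega>) \<le> ennreal C"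
    and "C \<ge> 0"
  shows "F_lim \<Omega> f u = 0"
proof -
  let ?M = "lebesgue_on \<Omega>"
  have fin: "finite_measure ?M" by (rule finite_measure_lebesgue_on[OF \<Omega>])
  define \<phi> where "\<phi> k x = f x (us k x) (Du k x)" for k x
  have [measurable]: "us k \<in> borel_measurable ?M" "Du k \<in> borel_measurable ?M" for k
    using us[of k] wg[of k] by (auto simp: Linf_def weak_grad_def)
  have \<phi>[measurable]: "\<phi> k \<in> borel_measurable ?M" for k
  proof -
    have "(\<lambda>x. (x, us k x, Du k x)) \<in> ?M \<rightarrow>\<^sub>M ?M \<Otimes>\<^sub>M (borel \<Otimes>\<^sub>M borel)"
      by measurable
    moreover have "(\<lambda>(x, u, \<xi>). f x u \<xi>) \<in> borel_measurable (?M \<Otimes>\<^sub>M (borel \<Otimes>\<^sub>M borel))"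
      using normal by (simp add: normal_integrand_def)
    ultimately have "(\<lambda>x. case (x, us k x, Du k x) of (x, u, \<xi>) \<Rightarrow> f x u \<xi>) \<in> borel_measurable ?M"
      by (rule measurable_compose)
    then show ?thesis
      unfolding \<phi>_def[abs_def] by simp
  qed
  have q1: "AE x in ?M. real k + 1 \<le> q k x" for k
    using q_ge[of k]
  proof eventually_elim
    case (elim x)
    moreover have "4 / \<gamma> > 0" using \<open>\<gamma> > 0\<close> by simp
    ultimately show ?case by linarith
  qed
  have q2: "AE x in ?M. 4 / \<gamma> \<le> q k x" for k
    using q_ge[of k] by eventually_elim linarith
  have energy': "(\<integral>\<^sup>+x. ennreal (1 / q k x * \<phi> k x powr q k x) \<partial>?M) \<le> ennreal C" for k
    using energy[of k] by (simp add: \<phi>_def)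
  have small: "AE x in ?M. \<forall>e>0. \<forall>\<^sub>F k in sequentially. \<phi> k x \<le> 1 + e"
    by (rule energy_bound_imp_AE_eventually_le[OF fin \<phi> q q1 energy' \<open>C \<ge> 0\<close>])
  have coercive: "AE x in ?M. \<alpha> * norm (Du k x) powr \<gamma> \<le> \<phi> k x" for k
    using H2 by eventually_elim (simp add: \<phi>_def)
  note sq = energy_bound_imp_square_integrable[OF fin \<open>\<alpha> > 0\<close> \<open>\<gamma> > 0\<close> _ \<phi> q q2 coercive energy' \<open>C \<ge> 0\<close>]
  define h where "h k x = (us k x, Du k x)" for k x
  obtain g D W where g: "\<And>n. g n \<in> mid_hull h n"
    and D[measurable]: "D \<in> borel_measurable ?M"
    and W: "integrable ?M W" "AE x in ?M. \<forall>n. norm (snd (g n x)) \<le> W x"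
    and gD: "AE x in ?M. (\<lambda>n. snd (g n x)) \<longlonglongrightarrow> D x"
    by (rule mid_hull_AE_convergent[where h = h, OF fin]) (use sq in \<open>auto simp: h_def\<close>)
  obtain N where N: "AE x in ?M. \<forall>m k. N m \<le> k \<longrightarrow> norm (us k x - u x) \<le> 1 / real (Suc m)"
    using Linf_conv_AE_uniform[OF conv] .
  have us_lim: "AE x in ?M. (\<lambda>k. us k x) \<longlonglongrightarrow> u x"
    using N by eventually_elim (rule LIMSEQ_if_eventually_le_inverse_Suc, blast)
  have g_N: "AE x in ?M. \<forall>m n. N m \<le> n \<longrightarrow> norm (fst (g n x) - u x) \<le> 1 / real (Suc m)"
    using N
  proof eventually_elim
    case (elim x)
    show ?case
    proof (intro allI impI)
      fix m n assume "N m \<le> n"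
      \<comment> \<open>A ball times the whole gradient space is convex and constrains only the
        function values.\<close>
      then have "g n x \<in> cball (u x) (1 / real (Suc m)) \<times> UNIV"
        using elim by (intro mid_hull_in_convex[OF g] convex_Times)
          (auto simp: h_def dist_norm norm_minus_commute)
      then show "norm (fst (g n x) - u x) \<le> 1 / real (Suc m)"
        by (auto simp: dist_norm norm_minus_commute mem_Times_iff)
    qed
  qed
  obtain Cu where Cu: "AE x in ?M. norm (u x) \<le> Cu"
    using u by (auto simp: Linf_def)
  have wgD: "weak_grad \<Omega> u D"
  proof (rule weak_grad_limit[OF \<Omega>])
    have "weak_grad \<Omega> (\<lambda>x. fst (g n x)) (\<lambda>x. snd (g n x))" for n
      using g[of n]
    proof induction
      case (base k)
      then show ?case using wg[of k] by (simp add: h_def)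
    next
      case (mid a b)
      from weak_grad_mid[OF mid.IH] show ?case by simp
    qed
    \<comment> \<open>From index \<open>N 0\<close> on, the case m = 0 keeps the averages within 1
      of u; the shift makes the bound \<open>Cu + 1\<close> valid for every k.\<close>
    then show "weak_grad \<Omega> (\<lambda>x. fst (g (k + N 0) x)) (\<lambda>x. snd (g (k + N 0) x))" for k .
    show "u \<in> borel_measurable ?M" using u by (simp add: Linf_def)
    show "AE x in ?M. norm (fst (g (k + N 0) x)) \<le> Cu + 1" for k
      using g_N Cu
    proof eventually_elim
      case (elim x)
      have "norm (fst (g (k + N 0) x) - u x) \<le> 1"
        using elim(1)[rule_format, of 0 "k + N 0"] by simp
      then show ?case
        using elim(2) norm_triangle_sub[of "fst (g (k + N 0) x)" "u x"] by simp
    qed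
    show "AE x in ?M. (\<lambda>k. fst (g (k + N 0) x)) \<longlonglongrightarrow> u x"
      using g_N by eventually_elim
        (rule LIMSEQ_ignore_initial_segment[OF LIMSEQ_if_eventually_le_inverse_Suc], blast)
    show "AE x in ?M. \<forall>k. norm (snd (g (k + N 0) x)) \<le> W x"
      using W(2) by eventually_elim blast
    show "AE x in ?M. (\<lambda>k. snd (g (k + N 0) x)) \<longlonglongrightarrow> D x"
      using gD by eventually_elim (rule LIMSEQ_ignore_initial_segment)
  qed (use D W in auto)
  have lsc: "AE x in ?M. lsc (\<lambda>(u, \<xi>). f x u \<xi>)"
    using normal by (simp add: normal_integrand_def)
  have le1: "AE x in ?M. f x (u x) (D x) \<le> 1"
    using lsc H1 H2 us_lim small gD
  proof eventually_elim
    case (elim x)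
    show ?case
    proof (rule lsc_level_convex_limit[where F = "f x" and u = "\<lambda>k. us k x" and \<xi> = "\<lambda>k. Du k x"
          and g = "\<lambda>n. snd (g n x)" and R = "(2 / \<alpha>) powr (1 / \<gamma>)"])
      \<comment> \<open>Eventually the density is at most 2, and coercivity turns this into the
        radius \<open>R\<close>.\<close>
      have "\<forall>\<^sub>F k in sequentially. \<phi> k x \<le> 1 + 1"
        using elim(5) zero_less_one by blast
      then show "\<forall>\<^sub>F j in sequentially. norm (Du j x) \<le> (2 / \<alpha>) powr (1 / \<gamma>)"
      proof eventually_elim
        case (elim k)
        have "\<alpha> * norm (Du k x) powr \<gamma> \<le> \<phi> k x"
          using \<open>\<forall>u \<xi>. \<alpha> * norm \<xi> powr \<gamma> \<le> f x u \<xi>\<close> by (simp add: \<phi>_def)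
        with elim show ?case
          using \<open>\<alpha> > 0\<close> \<open>\<gamma> > 0\<close> by (intro le_powr_inverse_exponent) auto
      qed
      show "snd (g n x) \<in> K" if "convex K" "\<And>j. j \<ge> n \<Longrightarrow> Du j x \<in> K" for K n
      proof -
        have "g n x \<in> UNIV \<times> K"
          using that by (intro mid_hull_in_convex[OF g] convex_Times) (auto simp: h_def)
        then show ?thesis by (simp add: mem_Times_iff)
      qed
    qed (use elim in \<open>auto simp: \<phi>_def\<close>)
  qed
  \<comment> \<open>Coercivity at the limit upgrades \<open>D\<close> from an L^2 limit to a bounded
    gradient.\<close>
  have "AE x in ?M. norm (D x) \<le> (1 / \<alpha>) powr (1 / \<gamma>)"
    using le1 H2
  proof eventually_elim
    case (elim x)
    have "\<alpha> * norm (D x) powr \<gamma> \<le> 1"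
      using elim by (meson order_trans)
    then show ?case
      using \<open>\<alpha> > 0\<close> \<open>\<gamma> > 0\<close> by (intro le_powr_inverse_exponent) auto
  qed
  then have "Linf \<Omega> D"
    unfolding Linf_def using D by blast
  then have "W1inf \<Omega> u"
    unfolding W1inf_def using u wgD by blast
  moreover have "AE x in ?M. \<bar>f x (u x) (D x)\<bar> \<le> 1"
    using le1 H2
  proof eventually_elim
    case (elim x)
    have "0 \<le> \<alpha> * norm (D x) powr \<gamma>" using \<open>\<alpha> > 0\<close> by simp
    also have "\<dots> \<le> f x (u x) (D x)" using elim by blast
    finally show ?case using elim by simp
  qed
  ultimately show ?thesis
    unfolding F_lim_def using wgD by auto
qed

subsection \<open>The two inequalities of the convergence\<close>

text \<open>The exponent conditions are essential bounds over the closure, while the energies are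
  integrals over \<Omega>.\<close>

lemma AE_lebesgue_on_subset:
  assumes "S \<subseteq> T" "S \<in> sets lebesgue" "T \<in> sets lebesgue" "AE x in lebesgue_on T. P x"
  shows "AE x in lebesgue_on S. P x"
proof -
  have "AE x in lebesgue. x \<in> T \<longrightarrow> P x"
    using assms(3,4) by (simp add: AE_restrict_space_iff)
  then have "AE x in lebesgue. x \<in> S \<longrightarrow> P x"
    by eventually_elim (use assms(1) in blast)
  then show ?thesis
    using assms(2) by (simp add: AE_restrict_space_iff)
qed

lemma eventually_AE_le_if_p_minus_tendsto_infinity:
  assumes "open \<Omega>" and lim: "(\<lambda>n. p_minus \<Omega> (p n)) \<longlonglongrightarrow> \<infinity>"
  shows "\<forall>\<^sub>F n in sequentially. AE x in lebesgue_on \<Omega>. R \<le> p n x"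
proof -
  have "\<forall>\<^sub>F n in sequentially. ereal R < p_minus \<Omega> (p n)"
    using lim by (simp add: tendsto_PInfty)
  then show ?thesis
  proof eventually_elim
    case (elim n)
    have "AE x in lebesgue_on (closure \<Omega>). - ereal (p n x) \<le> esssup (lebesgue_on (closure \<Omega>)) (\<lambda>x. - ereal (p n x))"
      by (rule esssup_AE)
    then have "AE x in lebesgue_on (closure \<Omega>). R \<le> p n x"
    proof eventually_elim
      case (elim x)
      then have "p_minus \<Omega> (p n) \<le> ereal (p n x)"
        unfolding p_minus_def by (simp add: ereal_uminus_le_reorder)
      with \<open>ereal R < p_minus \<Omega> (p n)\<close> have "ereal R < ereal (p n x)"
        by (rule less_le_trans)
      then show ?case by simp
    qed
    then show ?case
      by (rule AE_lebesgue_on_subset[OF closure_subset, rotated 2]) (use \<open>open \<Omega>\<close> in auto)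
  qed
qed

lemma AE_bounded_if_p_plus_le:
  assumes "open \<Omega>" and le: "p_plus \<Omega> p \<le> ereal \<beta> * p_minus \<Omega> p" and "\<beta> > 0"
  shows "\<exists>P. AE x in lebesgue_on \<Omega>. p x \<le> P"
proof -
  let ?M = "lebesgue_on (closure \<Omega>)"
  have "\<exists>P. AE x in ?M. p x \<le> P"
  proof (cases "p_minus \<Omega> p = \<infinity>")
    case True
    have "AE x in ?M. - ereal (p x) \<le> esssup ?M (\<lambda>x. - ereal (p x))"
      by (rule esssup_AE)
    \<comment> \<open>The left side - p(x) is real and cannot be at most -\<infinity>, so this case
      occurs only for a null closure, where any bound holds almost everywhere.\<close>
    then have "AE x in ?M. p x \<le> 0"
      by eventually_elim (use True in \<open>simp add: p_minus_def ereal_uminus_eq_reorder\<close>)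
    then show ?thesis by blast
  next
    case False
    have "AE x in ?M. ereal (p x) \<le> p_plus \<Omega> p"
      unfolding p_plus_def by (rule esssup_AE)
    moreover obtain P where "p_plus \<Omega> p \<le> ereal P"
      using le False \<open>\<beta> > 0\<close> by (cases "p_minus \<Omega> p") (auto intro: order_trans)
    ultimately have "AE x in ?M. p x \<le> P"
      by (auto elim!: eventually_mono intro: order_trans simp flip: ereal_less_eq(3))
    then show ?thesis by blast
  qed
  then obtain P where "AE x in ?M. p x \<le> P" by blast
  then have "AE x in lebesgue_on \<Omega>. p x \<le> P"
    by (rule AE_lebesgue_on_subset[OF closure_subset, rotated 2]) (use \<open>open \<Omega>\<close> in auto)
  then show ?thesis by blast
qed

text \<open>Replacing the bound by its maximum with 1 makes the power increasing in the exponent, so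
  \<open>P\<close> can replace the variable exponent.\<close>

lemma var_Lp_if_bounded:
  assumes \<Omega>: "\<Omega> \<in> lmeasurable"
    and g: "g \<in> borel_measurable (lebesgue_on \<Omega>)" "AE x in lebesgue_on \<Omega>. \<bar>g x\<bar> \<le> C"
    and p: "AE x in lebesgue_on \<Omega>. 0 \<le> p x \<and> p x \<le> P"
  shows "var_Lp \<Omega> p g"
proof -
  let ?M = "lebesgue_on \<Omega>"
  interpret finite_measure ?M by (rule finite_measure_lebesgue_on[OF \<Omega>])
  have "(\<integral>\<^sup>+x. ennreal (\<bar>g x\<bar> powr p x) \<partial>?M) \<le> (\<integral>\<^sup>+x. ennreal (max 1 C powr P) \<partial>?M)"
  proof (rule nn_integral_mono_AE)
    show "AE x in ?M. ennreal (\<bar>g x\<bar> powr p x) \<le> ennreal (max 1 C powr P)"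
      using g(2) p
    proof eventually_elim
      case (elim x)
      have "\<bar>g x\<bar> powr p x \<le> max 1 C powr p x"
        using elim by (intro powr_mono2) auto
      also have "\<dots> \<le> max 1 C powr P"
        using elim by (intro powr_mono) auto
      finally show ?case by (rule ennreal_leI)
    qed
  qed
  also have "\<dots> < \<infinity>"
    by (simp add: emeasure_eq_measure ennreal_mult_less_top)
  finally show ?thesis
    using g(1) by (simp add: var_Lp_def)
qed

text \<open>When the constraint holds, the density is at most 1/p_n. It remains to see that u lies
  in every variable exponent space and that the selected gradient satisfies the constraint
  too.\<close>

lemma limsup_F_n_const:
  fixes \<Omega> :: "(real^'n::finite) set"
    and f :: "real^'n \<Rightarrow> real^'d::finite \<Rightarrow> real^'n^'d \<Rightarrow> real"
  assumes \<Omega>: "\<Omega> \<in> lmeasurable" "open \<Omega>"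
    and p_pos: "\<And>n x. x \<in> \<Omega> \<Longrightarrow> 0 < p n x"
    and p_large: "\<And>R. \<forall>\<^sub>F n in sequentially. AE x in lebesgue_on \<Omega>. R \<le> p n x"
    and p_bdd: "\<And>n. \<exists>P. AE x in lebesgue_on \<Omega>. p n x \<le> P"
    and f_nonneg: "AE x in lebesgue_on \<Omega>. \<forall>u \<xi>. 0 \<le> f x u \<xi>"
  shows "limsup (\<lambda>n. F_n \<Omega> f (p n) u) \<le> F_lim \<Omega> f u"
proof (cases "W1inf \<Omega> u \<and> (\<exists>Du. weak_grad \<Omega> u Du \<and> (AE x in lebesgue_on \<Omega>. \<bar>f x (u x) (Du x)\<bar> \<le> 1))")
  case False
  then have "F_lim \<Omega> f u = \<infinity>" by (simp only: F_lim_def if_False)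
  then show ?thesis by simp
next
  case True
  let ?M = "lebesgue_on \<Omega>"
  interpret finite_measure ?M by (rule finite_measure_lebesgue_on[OF \<Omega>(1)])
  have lim0: "F_lim \<Omega> f u = 0" unfolding F_lim_def using True by (rule if_P)
  define D where "D = (SOME Du. weak_grad \<Omega> u Du)"
  from True obtain Du where Du: "weak_grad \<Omega> u Du" "AE x in ?M. \<bar>f x (u x) (Du x)\<bar> \<le> 1"
    by blast
  have D: "weak_grad \<Omega> u D"
    unfolding D_def using someI[of "weak_grad \<Omega> u" Du] Du(1) by simp
  have "AE x in ?M. D x = Du x"
    by (rule weak_grad_unique[OF \<Omega>(2) D Du(1)])
  with Du(2) have D1: "AE x in ?M. \<bar>f x (u x) (D x)\<bar> \<le> 1"
    by eventually_elim simp
  have space: "AE x in ?M. x \<in> \<Omega>"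
    by (rule AE_I2) simp
  have W1p: "var_W1p \<Omega> (p n) u" for n
  proof -
    obtain P where P: "AE x in ?M. p n x \<le> P" using p_bdd by blast
    from P space have P': "AE x in ?M. 0 \<le> p n x \<and> p n x \<le> P"
      by eventually_elim (use p_pos in \<open>auto intro: less_imp_le\<close>)
    \<comment> \<open>The bounded gradient given by \<open>W1inf\<close> may be a different
      representative from \<open>Du\<close>; membership in \<open>var_W1p\<close> asks only that
      some gradient be integrable.\<close>
    obtain E C C' where u: "u \<in> borel_measurable ?M" "AE x in ?M. norm (u x) \<le> C"
      and E: "weak_grad \<Omega> u E" "E \<in> borel_measurable ?M" "AE x in ?M. norm (E x) \<le> C'"
      using True by (auto simp: W1inf_def Linf_def)
    have "var_Lp \<Omega> (p n) (\<lambda>x. norm (u x))"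
      using u by (intro var_Lp_if_bounded[OF \<Omega>(1) _ _ P']) auto
    moreover have "var_Lp \<Omega> (p n) (\<lambda>x. norm (column i (E x)))" for i
    proof -
      interpret column: bounded_linear "column i :: real^'n^'d \<Rightarrow> _"
        by (rule bounded_linear_column)
      obtain K where K: "K > 0" "\<And>A :: real^'n^'d. norm (column i A) \<le> norm A * K"
        using column.pos_bounded by blast
      have "(column i :: real^'n^'d \<Rightarrow> _) \<in> borel_measurable borel"
        by (intro borel_measurable_continuous_onI column.continuous_on continuous_on_id)
      from measurable_compose[OF E(2) this] have "(\<lambda>x. norm (column i (E x))) \<in> borel_measurable ?M"
        by simp
      moreover have "AE x in ?M. \<bar>norm (column i (E x))\<bar> \<le> C' * K"
        using E(3)
      proof eventually_elim
        case (elim x)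
        then have "norm (E x) * K \<le> C' * K"
          using K(1) by simp
        with K(2)[of "E x"] show ?case by simp
      qed
      ultimately show ?thesis
        by (rule var_Lp_if_bounded[OF \<Omega>(1) _ _ P'])
    qed
    ultimately show ?thesis
      using u(1) E(1) by (auto simp: var_W1p_def)
  qed
  have "limsup (\<lambda>n. F_n \<Omega> f (p n) u) \<le> 0"
  proof (rule ennreal_le_epsilon)
    fix e :: real assume "e > 0"
    \<comment> \<open>Chosen so that the measure of \<Omega> divided by R is at most e; the added 1
      keeps R positive if that measure is 0.\<close>
    define R where "R = measure ?M (space ?M) / e + 1"
    have "R > 0"
      unfolding R_def using \<open>e > 0\<close> by (intro add_nonneg_pos divide_nonneg_pos) auto
    moreover have "measure ?M (space ?M) \<le> e * R"
      unfolding R_def using \<open>e > 0\<close> by (simp add: distrib_left)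
    ultimately have R: "R > 0" "measure ?M (space ?M) / R \<le> e"
      by (simp_all add: pos_divide_le_eq)
    have "\<forall>\<^sub>F n in sequentially. F_n \<Omega> f (p n) u \<le> ennreal e"
      using p_large[of R]
    proof eventually_elim
      case (elim n)
      have "F_n \<Omega> f (p n) u = (\<integral>\<^sup>+x. ennreal (1 / p n x * f x (u x) (D x) powr p n x) \<partial>?M)"
        by (simp add: F_n_def W1p Let_def D_def)
      also have "\<dots> \<le> (\<integral>\<^sup>+x. ennreal (1 / R) \<partial>?M)"
      proof (rule nn_integral_mono_AE)
        show "AE x in ?M. ennreal (1 / p n x * f x (u x) (D x) powr p n x) \<le> ennreal (1 / R)"
          using elim f_nonneg D1
        proof eventually_elim
          case (elim x)
          have "f x (u x) (D x) powr p n x \<le> 1 powr p n x"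
            using elim R by (intro powr_mono2) auto
          then have "1 / p n x * f x (u x) (D x) powr p n x \<le> 1 / R * 1"
            using elim R by (intro mult_mono) (auto simp: frac_le)
          then show ?case by (intro ennreal_leI) simp
        qed
      qed
      also have "\<dots> = ennreal (measure ?M (space ?M) / R)"
        using R by (simp add: emeasure_eq_measure flip: ennreal_mult)
      also have "\<dots> \<le> ennreal e"
        by (intro ennreal_leI R)
      finally show ?case .
    qed
    then show "limsup (\<lambda>n. F_n \<Omega> f (p n) u) \<le> 0 + ennreal e"
      by (simp add: Limsup_bounded)
  qed
  then show ?thesis by (simp add: lim0)
qed

text \<open>The condition \<open>k \<le> r k\<close> already forces \<open>r\<close> to infinity, so
  an index sequence chosen term by term qualifies.\<close>

lemma Linf_conv_subseq:
  fixes r :: "nat \<Rightarrow> nat"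
  assumes "\<And>k. k \<le> r k" and conv: "Linf_conv \<Omega> us u"
  shows "Linf_conv \<Omega> (\<lambda>k. us (r k)) u"
  unfolding Linf_conv_def
proof (intro allI impI)
  fix e :: real assume "e > 0"
  have r: "filterlim r at_top sequentially"
    using assms(1) by (rule filterlim_at_top_mono[OF filterlim_ident always_eventually[OF allI]])
  have "\<forall>\<^sub>F n in sequentially. AE x in lebesgue_on \<Omega>. norm (us n x - u x) \<le> e"
    using conv \<open>e > 0\<close> by (simp add: Linf_conv_def)
  then show "\<forall>\<^sub>F k in sequentially. AE x in lebesgue_on \<Omega>. norm (us (r k) x - u x) \<le> e"
    by (rule eventually_compose_filterlim[OF _ r])
qed

text \<open>\<open>F_lim\<close> takes only the values 0 and \<infinity>, so it suffices that it
  vanishes whenever the lower limit is finite.\<close>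

lemma liminf_F_n_ge:
  fixes \<Omega> :: "(real^'n::finite) set"
    and f :: "real^'n \<Rightarrow> real^'d::finite \<Rightarrow> real^'n^'d \<Rightarrow> real"
  assumes \<Omega>: "\<Omega> \<in> lmeasurable"
    and normal: "normal_integrand \<Omega> f"
    and H1: "AE x in lebesgue_on \<Omega>. \<forall>u. level_convex (f x u)"
    and \<alpha>: "\<alpha> > 0" and \<gamma>: "\<gamma> > 0"
    and H2: "AE x in lebesgue_on \<Omega>. \<forall>u \<xi>. f x u \<xi> \<ge> \<alpha> * norm \<xi> powr \<gamma>"
    and p: "\<And>n. p n \<in> borel_measurable (lebesgue_on \<Omega>)"
    and p_large: "\<And>R. \<forall>\<^sub>F n in sequentially. AE x in lebesgue_on \<Omega>. R \<le> p n x"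
    and u: "Linf \<Omega> u" and us: "\<And>n. Linf \<Omega> (us n)" and conv: "Linf_conv \<Omega> us u"
  shows "F_lim \<Omega> f u \<le> liminf (\<lambda>n. F_n \<Omega> f (p n) (us n))"
proof (cases "liminf (\<lambda>n. F_n \<Omega> f (p n) (us n)) = \<infinity>")
  case False
  then have "\<not> \<infinity> \<le> liminf (\<lambda>n. F_n \<Omega> f (p n) (us n))"
    by (simp add: top.extremum_unique)
  then obtain C where C: "C < \<infinity>" "\<exists>\<^sub>F n in sequentially. F_n \<Omega> f (p n) (us n) \<le> C"
    by (auto simp: le_Liminf_iff not_eventually not_less)
  have "\<exists>n\<ge>k. F_n \<Omega> f (p n) (us n) \<le> C \<and> (AE x in lebesgue_on \<Omega>. real k + 1 + 4 / \<gamma> \<le> p n x)" for k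
  proof -
    \<comment> \<open>A bound that holds infinitely often meets an exponent condition that holds
      eventually, so each k has a suitable index beyond it.\<close>
    have "\<exists>\<^sub>F n in sequentially. F_n \<Omega> f (p n) (us n) \<le> C \<and> (AE x in lebesgue_on \<Omega>. real k + 1 + 4 / \<gamma> \<le> p n x)"
    proof (rule frequently_rev_mp[OF C(2)])
      show "\<forall>\<^sub>F n in sequentially. F_n \<Omega> f (p n) (us n) \<le> C \<longrightarrow>
          F_n \<Omega> f (p n) (us n) \<le> C \<and> (AE x in lebesgue_on \<Omega>. real k + 1 + 4 / \<gamma> \<le> p n x)"
        using p_large[of "real k + 1 + 4 / \<gamma>"] by eventually_elim simp
    qed
    then show ?thesis
      by (simp add: frequently_sequentially)
  qed
  then obtain r where r: "\<And>k. k \<le> r k" "\<And>k. F_n \<Omega> f (p (r k)) (us (r k)) \<le> C"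
    "\<And>k. AE x in lebesgue_on \<Omega>. real k + 1 + 4 / \<gamma> \<le> p (r k) x"
    by metis
  \<comment> \<open>The same choice as inside \<open>F_n\<close>, so the bound on \<open>F_n\<close>
    is literally the energy bound for \<open>Du k\<close>.\<close>
  define Du where "Du k = (SOME Du. weak_grad \<Omega> (us (r k)) Du)" for k
  have W1p: "var_W1p \<Omega> (p (r k)) (us (r k))" for k
  proof (rule ccontr)
    assume "\<not> ?thesis"
    then have "F_n \<Omega> f (p (r k)) (us (r k)) = \<infinity>" by (simp add: F_n_def)
    with r(2)[of k] C(1) show False by simp
  qed
  have "F_lim \<Omega> f u = 0"
  proof (rule bounded_energy_imp_F_lim_eq_0[where us = "\<lambda>k. us (r k)" and q = "\<lambda>k. p (r k)" and Du = Du
        and C = "enn2real C", OF \<Omega> normal H1 \<alpha> \<gamma> H2 u])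
    show "Linf \<Omega> (us (r k))" for k by (rule us)
    show "Linf_conv \<Omega> (\<lambda>k. us (r k)) u"
      using r(1) conv by (rule Linf_conv_subseq)
    show "weak_grad \<Omega> (us (r k)) (Du k)" for k
      using someI_ex[of "weak_grad \<Omega> (us (r k))"] W1p[of k] by (auto simp: var_W1p_def Du_def)
    show "p (r k) \<in> borel_measurable (lebesgue_on \<Omega>)" for k by (rule p)
    show "AE x in lebesgue_on \<Omega>. real k + 1 + 4 / \<gamma> \<le> p (r k) x" for k by (rule r)
    show "(\<integral>\<^sup>+x. ennreal (1 / p (r k) x * f x (us (r k) x) (Du k x) powr p (r k) x) \<partial>lebesgue_on \<Omega>)
        \<le> ennreal (enn2real C)" for k
      using r(2)[of k] W1p[of k] C(1) by (simp add: F_n_def Let_def Du_def)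
  qed simp
  then show ?thesis by simp
qed simp

lemma Linf_if_in_C_space:
  assumes "open \<Omega>" "u \<in> C_space \<Omega>"
  shows "Linf \<Omega> u"
proof -
  obtain C where C: "\<And>x. x \<in> \<Omega> \<Longrightarrow> norm (u x) \<le> C"
    using assms(2) by (auto simp: C_space_def bounded_iff)
  have "AE x in lebesgue_on \<Omega>. norm (u x) \<le> C"
    by (rule AE_I2) (simp add: C)
  moreover have "u \<in> borel_measurable (lebesgue_on \<Omega>)"
    using assms by (intro continuous_imp_measurable_on_sets_lebesgue) (auto simp: C_space_def)
  ultimately show ?thesis by (auto simp: Linf_def)
qed

theorem theorem4p5:
  fixes \<Omega> :: "(real^'n) set"
    and p :: "nat \<Rightarrow> real^'n \<Rightarrow> real"
    and f :: "real^'n \<Rightarrow> real^'d \<Rightarrow> real^'n^'d \<Rightarrow> real"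
    and X :: "(real^'n \<Rightarrow> real^'d) set"
  assumes "bounded \<Omega>" and "open \<Omega>"
    and p_meas: "\<And>n. p n \<in> borel_measurable (lebesgue_on (closure \<Omega>))"
    and p_gt1: "\<And>n x. x \<in> closure \<Omega> \<Longrightarrow> p n x > 1"
    and p_minus_lim: "(\<lambda>n. p_minus \<Omega> (p n)) \<longlonglongrightarrow> \<infinity>"
    and beta: "\<exists>\<beta>>1. \<forall>n. p_plus \<Omega> (p n) \<le> ereal \<beta> * p_minus \<Omega> (p n)"
    and normal: "normal_integrand \<Omega> f"
    and H1: "AE x in lebesgue_on \<Omega>. \<forall>u. level_convex (f x u)"
    and H2: "\<exists>\<alpha>>0. \<exists>\<gamma>>0. AE x in lebesgue_on \<Omega>. \<forall>u \<xi>. f x u \<xi> \<ge> \<alpha> * norm \<xi> powr \<gamma>"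
    and X: "X = Linf_space \<Omega> \<or> X = C_space \<Omega>"
  shows "(\<forall>u\<in>X. \<forall>us. (\<forall>n. us n \<in> X) \<and> Linf_conv \<Omega> us u \<longrightarrow>
            F_lim \<Omega> f u \<le> liminf (\<lambda>n. F_n \<Omega> f (p n) (us n)))
       \<and> (\<forall>u\<in>X. \<exists>us. (\<forall>n. us n \<in> X) \<and> Linf_conv \<Omega> us u \<and>
            limsup (\<lambda>n. F_n \<Omega> f (p n) (us n)) \<le> F_lim \<Omega> f u)"
proof -
  have \<Omega>: "\<Omega> \<in> lmeasurable"
    using \<open>bounded \<Omega>\<close> \<open>open \<Omega>\<close> by (rule lmeasurable_open)
  \<comment> \<open>Both choices of \<open>X\<close> consist of essentially bounded functions and
    contain the constant sequence at each element, so they are treated together.\<close>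
  have Linf: "Linf \<Omega> v" if "v \<in> X" for v
    using X that Linf_if_in_C_space[OF \<open>open \<Omega>\<close>] by (auto simp: Linf_space_def)
  have p: "p n \<in> borel_measurable (lebesgue_on \<Omega>)" for n
    using p_meas[of n] closure_subset by (rule measurable_restrict_mono)
  obtain \<alpha> \<gamma> where "\<alpha> > 0" "\<gamma> > 0"
    and coercive: "AE x in lebesgue_on \<Omega>. \<forall>u \<xi>. f x u \<xi> \<ge> \<alpha> * norm \<xi> powr \<gamma>"
    using H2 by blast
  have f_nonneg: "AE x in lebesgue_on \<Omega>. \<forall>u \<xi>. 0 \<le> f x u \<xi>"
    using coercive
  proof eventually_elim
    case (elim x)
    moreover have "0 \<le> \<alpha> * norm \<xi> powr \<gamma>" for \<xi> :: "real^'n^'d"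
      using \<open>\<alpha> > 0\<close> by simp
    ultimately show ?case by (meson order_trans)
  qed
  note p_large = eventually_AE_le_if_p_minus_tendsto_infinity[OF \<open>open \<Omega>\<close> p_minus_lim]
  obtain \<beta> where "\<beta> > 1" "\<And>n. p_plus \<Omega> (p n) \<le> ereal \<beta> * p_minus \<Omega> (p n)"
    using beta by blast
  then have p_bdd: "\<exists>P. AE x in lebesgue_on \<Omega>. p n x \<le> P" for n
    by (intro AE_bounded_if_p_plus_le[OF \<open>open \<Omega>\<close>]) auto
  have p_pos: "0 < p n x" if "x \<in> \<Omega>" for n x
    using p_gt1[of x n] that closure_subset[of \<Omega>] by force
  show ?thesis
  proof (intro conjI ballI allI impI)
    fix u us assume "u \<in> X" "(\<forall>n. us n \<in> X) \<and> Linf_conv \<Omega> us u"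
    then show "F_lim \<Omega> f u \<le> liminf (\<lambda>n. F_n \<Omega> f (p n) (us n))"
      by (intro liminf_F_n_ge[OF \<Omega> normal H1 \<open>\<alpha> > 0\<close> \<open>\<gamma> > 0\<close> coercive p p_large] Linf) auto
  next
    fix u assume "u \<in> X"
    moreover have "Linf_conv \<Omega> (\<lambda>_. u) u"
      by (simp add: Linf_conv_def)
    ultimately show "\<exists>us. (\<forall>n. us n \<in> X) \<and> Linf_conv \<Omega> us u \<and>
        limsup (\<lambda>n. F_n \<Omega> f (p n) (us n)) \<le> F_lim \<Omega> f u"
      using limsup_F_n_const[OF \<Omega> \<open>open \<Omega>\<close> p_pos p_large p_bdd f_nonneg]
      by (intro exI[of _ "\<lambda>_. u"]) auto
  qed
qed

end
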